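(* Let $\alpha<0$. For any initial datum $u_0\in\mathcal{L}(1)$, let $u(t)=\dfrac{a(t)z+b(t)}{1-p(t)z}$ be the corresponding solution of the $\alpha$-Szegő equation $i\partial_tu=\Pi(|u|^2u)+\alpha(u|1)$, $u(0)=u_0$. Then for every $s\ge\frac12$ there exists a constant $C>0$ such that $\|u(t)\|_{H^s}<C$ for all $t\in\mathbb{R}$. Moreover the constant $C$ is uniform for $u_0$ in a compact subset of $\mathcal{L}(1)$: for every $s\ge\frac12$ and every compact $\mathcal{K}\subset\mathcal{L}(1)$ there is a constant $C>0$ such that $\|u(t)\|_{H^s}<C$ for all $t\in\mathbb{R}$ and all $u_0\in\mathcal{K}$.
   Context: $\mathbb{S}^1=\{z\in\mathbb{C}:|z|=1\}$, $z=e^{i\theta}$; $(u|v)=\frac1{2\pi}\int_{-\pi}^{\pi}u(e^{ix})\overline{v(e^{ix})}\,dx$; the Szegő projector is $\Pi\big(\sum_{k\in\mathbb{Z}}\hat u(k)e^{ik\theta}\big)=\sum_{k\ge0}\hat u(k)e^{ik\theta}$; $L^2_+$ is the subspace of $L^2(\mathbb{S}^1)$ of functions with $\hat u(k)=0$ for $k<0$, and $H^s_+=H^s(\mathbb{S}^1)\cap L^2_+$, $\|u\|_{H^s}^2=\sum_k(1+k^2)^s|\hat u(k)|^2$. The $\alpha$-Szegő equation is globally well-posed in $H^s_+$ for $s\ge\frac12$ (unique global solution). For $u\in H^{1/2}_+$, the Hankel operator is $H_u(h)=\Pi(u\bar h)$ on $L^2_+$, and $K_u=T_z^*H_u$, where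 $T_z^*h=\Pi(\bar z h)$. $\mathcal{L}(1)=\{u\in H^{1/2}_+:\operatorname{rk}K_u=1\}$; equivalently, $\mathcal{L}(1)$ is the set of functions $u=b+\frac{cz}{1-pz}$ with $b\in\mathbb{C}$, $c\in\mathbb{C}\setminus\{0\}$, $p\in\mathbb{C}$, $|p|<1$, and it is invariant under the flow. It is given the topology of the coordinates $(b,c,p)\in\mathbb{C}\times(\mathbb{C}\setminus\{0\})\times\{|p|<1\}$. *)

theory Defs
  imports "HOL-Analysis.Analysis" "HOL-Library.Function_Algebras"
begin

text \<open>
  Functions on the unit circle are maps of type \<^typ>\<open>complex \<Rightarrow> complex\<close> of which only the
  values at \<open>cis x\<close> matter. Elements of \<open>L\<^sup>2\<close> are represented by functions, not by classes
  modulo null sets; \<open>eq_circ\<close> is the corresponding identification.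
\<close>

abbreviation angle :: "real measure" where
  "angle \<equiv> lebesgue_on {-pi..pi}"

definition eq_circ :: "(complex \<Rightarrow> complex) \<Rightarrow> (complex \<Rightarrow> complex) \<Rightarrow> bool" where
  "eq_circ u v \<longleftrightarrow> (AE x in angle. u (cis x) = v (cis x))"

definition inner_circ :: "(complex \<Rightarrow> complex) \<Rightarrow> (complex \<Rightarrow> complex) \<Rightarrow> complex" where
  "inner_circ u v = (\<integral>x. u (cis x) * cnj (v (cis x)) \<partial>angle) / complex_of_real (2 * pi)"

definition L2 :: "(complex \<Rightarrow> complex) set" where
  "L2 = {u. (\<lambda>x. u (cis x)) \<in> borel_measurable angle \<and>
            integrable angle (\<lambda>x. (cmod (u (cis x)))\<^sup>2)}"

definition L2_norm :: "(complex \<Rightarrow> complex) \<Rightarrow> real" where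
  "L2_norm u = sqrt ((\<integral>x. (cmod (u (cis x)))\<^sup>2 \<partial>angle) / (2 * pi))"

definition fourier :: "(complex \<Rightarrow> complex) \<Rightarrow> int \<Rightarrow> complex" where
  "fourier u k = inner_circ u (\<lambda>z. z powi k)"

definition L2_plus :: "(complex \<Rightarrow> complex) set" where
  "L2_plus = {u \<in> L2. \<forall>k<0. fourier u k = 0}"

definition H_plus :: "real \<Rightarrow> (complex \<Rightarrow> complex) set" where
  "H_plus s = {u \<in> L2_plus.
     (\<lambda>k::int. (1 + (real_of_int k)\<^sup>2) powr s * (cmod (fourier u k))\<^sup>2) summable_on UNIV}"

definition H_norm :: "real \<Rightarrow> (complex \<Rightarrow> complex) \<Rightarrow> real" where
  "H_norm s u =
     sqrt (\<Sum>\<^sub>\<infinity>k::int. (1 + (real_of_int k)\<^sup>2) powr s * (cmod (fourier u k))\<^sup>2)"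

text \<open>
  The value of the Szego projector is an \<open>L\<^sup>2\<close> representative, determined up to null sets. It
  exists (Riesz-Fischer) as soon as the coefficients of \<open>f\<close> of nonnegative index are square
  summable. This covers \<open>f \<in> L\<^sup>2\<close> and also the merely integrable products \<open>u * cnj h\<close> with
  \<open>u \<in> H\<^sup>1\<^sup>/\<^sup>2\<close>, \<open>h \<in> L\<^sup>2\<close> to which the Hankel operator applies it.
\<close>

definition szego :: "(complex \<Rightarrow> complex) \<Rightarrow> (complex \<Rightarrow> complex)" where
  "szego f = (SOME g. g \<in> L2 \<and> (\<forall>k. fourier g k = (if 0 \<le> k then fourier f k else 0)))"

definition shift_adj :: "(complex \<Rightarrow> complex) \<Rightarrow> (complex \<Rightarrow> complex)" where
  "shift_adj h = szego (\<lambda>z. cnj z * h z)"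

definition hankel :: "(complex \<Rightarrow> complex) \<Rightarrow> (complex \<Rightarrow> complex) \<Rightarrow> (complex \<Rightarrow> complex)" where
  "hankel u h = szego (\<lambda>z. u z * cnj (h z))"

definition K_op :: "(complex \<Rightarrow> complex) \<Rightarrow> (complex \<Rightarrow> complex) \<Rightarrow> (complex \<Rightarrow> complex)" where
  "K_op u h = shift_adj (hankel u h)"

text \<open>
  Rank of \<open>K_op u\<close> on \<open>L\<^sup>2\<^sub>+\<close>: the complex dimension of its range. The range is measured
  through Fourier coefficients, which are linear and injective on \<open>L\<^sup>2\<close> modulo null sets. The
  library's \<open>dim\<close> is 0 in infinite dimension, so rank 1 really means one-dimensional range.
\<close>

definition rank_K :: "(complex \<Rightarrow> complex) \<Rightarrow> nat" where
  "rank_K u = vector_space.dim (\<lambda>(c::complex) (f::int \<Rightarrow> complex) k. c * f k)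
                ((\<lambda>h. fourier (K_op u h)) ` L2_plus)"

definition L1 :: "(complex \<Rightarrow> complex) set" where
  "L1 = {u \<in> H_plus (1/2). rank_K u = 1}"

text \<open>
  \<open>L1\<close> carries the topology of the coordinates \<open>(b, c, p)\<close> of \<open>b + c z / (1 - p z)\<close>: a set of
  (representatives of) functions in \<open>L1\<close> is compact iff the set of its coordinates is a compact
  subset of the coordinate domain.
\<close>

definition coord_fun :: "complex \<times> complex \<times> complex \<Rightarrow> complex \<Rightarrow> complex" where
  "coord_fun = (\<lambda>(b, c, p) z. b + c * z / (1 - p * z))"

definition coord_dom :: "(complex \<times> complex \<times> complex) set" where
  "coord_dom = UNIV \<times> (- {0}) \<times> {p. cmod p < 1}"

definition compact_in_L1 :: "(complex \<Rightarrow> complex) set \<Rightarrow> bool" where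
  "compact_in_L1 K \<longleftrightarrow> K \<subseteq> L1 \<and>
     (\<exists>Q. compact Q \<and> Q \<subseteq> coord_dom \<and>
          (\<forall>u\<in>K. \<exists>q\<in>Q. eq_circ u (coord_fun q)) \<and>
          (\<forall>q\<in>Q. \<exists>u\<in>K. eq_circ u (coord_fun q)))"

text \<open>
  Global solutions \<open>u \<in> C(\<real>, H\<^sup>1\<^sup>/\<^sup>2\<^sub>+)\<close> of
  \<open>i \<partial>\<^sub>t u = \<Pi>(|u|\<^sup>2 u) + \<alpha> (u|1)\<close>. For such \<open>u\<close> the right-hand side is in \<open>L\<^sup>2\<close>, and the time
  derivative is taken in \<open>L\<^sup>2\<close>.
\<close>

definition szego_solution :: "real \<Rightarrow> (real \<Rightarrow> complex \<Rightarrow> complex) \<Rightarrow> bool" where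
  "szego_solution \<alpha> u \<longleftrightarrow>
     (\<forall>t. u t \<in> H_plus (1/2)) \<and>
     (\<forall>t. ((\<lambda>\<tau>. H_norm (1/2) (\<lambda>z. u \<tau> z - u t z)) \<longlongrightarrow> 0) (at t)) \<and>
     (\<forall>t. ((\<lambda>h. L2_norm (\<lambda>z. \<i> * ((u (t + h) z - u t z) / complex_of_real h)
                  - (szego (\<lambda>w. (complex_of_real (cmod (u t w)))\<^sup>2 * u t w) z
                     + complex_of_real \<alpha> * inner_circ (u t) (\<lambda>_. 1)))) \<longlongrightarrow> 0) (at 0))"

text \<open>
  \<open>u\<close> is the solution issued from \<open>u0\<close>, written as \<open>u(t) = (a(t) z + b(t)) / (1 - p(t) z)\<close>.
\<close>

definition solution_from ::
  "real \<Rightarrow> (complex \<Rightarrow> complex) \<Rightarrow> (real \<Rightarrow> complex \<Rightarrow> complex) \<Rightarrow>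
   (real \<Rightarrow> complex) \<Rightarrow> (real \<Rightarrow> complex) \<Rightarrow> (real \<Rightarrow> complex) \<Rightarrow> bool" where
  "solution_from \<alpha> u0 u a b p \<longleftrightarrow>
     szego_solution \<alpha> u \<and> eq_circ (u 0) u0 \<and>
     (\<forall>t. cmod (p t) < 1 \<and> eq_circ (u t) (\<lambda>z. (a t * z + b t) / (1 - p t * z)))"

end

theory Submission
  imports Defs "HOL-Real_Asymp.Real_Asymp"
begin

text \<open>
  Write \<open>u = b + c z / (1 - p z)\<close> and \<open>r = 1 - \<bar>p\<bar>\<^sup>2\<close>. The Fourier coefficients of \<open>u\<close> are
  \<open>b\<close> and \<open>c p\<^sup>m\<close>, so a Sobolev norm can only become large if \<open>b\<close> or \<open>c\<close> does or if the pole
  reaches the circle, \<open>r \<rightarrow> 0\<close>. Three conserved quantities exclude this: the mass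
  \<open>Q = \<bar>b\<bar>\<^sup>2 + \<bar>c\<bar>\<^sup>2 / r\<close>, the momentum \<open>M = \<bar>c\<bar>\<^sup>2 / r\<^sup>2\<close>, and
  \<open>G = r (\<bar>u(cnj p)\<bar>\<^sup>2 - \<alpha>)\<close> with \<open>u(cnj p) = b + c (cnj p) / r\<close>. The last one is the energy in
  disguise: if \<open>E = \<parallel>u\<parallel>\<^sub>4\<^sup>4 / 4 + \<alpha> \<bar>(u|1)\<bar>\<^sup>2 / 2\<close>, then \<open>4 E = Q\<^sup>2 + 2 \<alpha> Q + 2 M G\<close>. For \<open>\<alpha> < 0\<close> both
  terms of \<open>G\<close> are nonnegative, hence \<open>G \<ge> \<bar>\<alpha>\<bar> r\<close>, while \<open>\<bar>u(cnj p)\<bar>\<^sup>2 \<le> 2 (Q + M)\<close>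
  gives \<open>G \<le> (2 Q + 2 M + \<bar>\<alpha>\<bar>) r\<close>. Comparing the two at different times,
  \<open>r(t) \<ge> \<bar>\<alpha>\<bar> r(0) / (2 Q + 2 M + \<bar>\<alpha>\<bar>)\<close>, a bound that depends only on bounds for the initial coordinates; this is why it is uniform on
  compact sets (\<open>uniform_bounds\<close>).

  The coordinates satisfy ordinary differential equations because \<open>L\<^sup>2\<close> differentiability of
  \<open>u\<close> makes each Fourier coefficient differentiable; the coefficients of index 0, 1, 2 are \<open>b\<close>,
  \<open>c\<close> and \<open>c p\<close>, which determine the motion as long as \<open>c \<noteq> 0\<close>. Computing their derivatives
  needs the corresponding coefficients of \<open>\<bar>u\<bar>\<^sup>2 u\<close>, obtained as the product of the power series
  of \<open>u\<^sup>2\<close> and the conjugate of that of \<open>u\<close> (\<open>pole_cubic_values\<close>).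

  When \<open>c = 0\<close> the function is constant, \<open>p\<close> carries no information and the conservation laws are
  not available. But on the connected component of \<open>{c \<noteq> 0}\<close> around a given time the bound on \<open>r\<close>
  keeps \<open>\<bar>c\<bar>\<^sup>2 = M r\<^sup>2\<close> away from 0, so that component is closed as well as open and is the
  whole line (\<open>never_constant\<close>). A solution is thus constant on the circle at all times or at none,
  and in the first case \<open>\<bar>b\<bar>\<close> is conserved.
\<close>

section \<open>Fourier coefficients on the circle\<close>

lemma finite_measure_angle: "finite_measure angle"
  by (rule finite_measure_lebesgue_on) (metis interval_cbox lmeasurable_cbox)

lemma cis_measurable [measurable]: "cis \<in> borel_measurable angle"
  by (rule continuous_imp_measurable_on_sets_lebesgue) (auto intro!: continuous_intros)

lemma circle_char_measurable [measurable]: "(\<lambda>x. cis x powi k) \<in> borel_measurable angle"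
  unfolding cis_power_int
  by (rule continuous_imp_measurable_on_sets_lebesgue) (auto intro!: continuous_intros)

lemma cnj_measurable [measurable (raw)]:
  "f \<in> borel_measurable M \<Longrightarrow> (\<lambda>x. cnj (f x)) \<in> borel_measurable M"
  by (erule measurable_compose) (intro borel_measurable_continuous_onI continuous_intros)

lemma integrable_angle_bounded:
  fixes f :: "real \<Rightarrow> 'a::{banach,second_countable_topology}"
  assumes "f \<in> borel_measurable angle" and "\<And>x. norm (f x) \<le> B"
  shows "integrable angle f"
  using assms by (intro finite_measure.integrable_const_bound[OF finite_measure_angle]) auto

lemma cnj_circle_char: "cnj (cis x powi k) = cis x powi (- k)"
  by (simp add: cis_power_int cis_cnj)

lemma integral_circle_char:
  "(\<integral>x. cis x powi k \<partial>angle) = (if k = 0 then complex_of_real (2 * pi) else 0)"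
proof -
  have cont: "continuous_on {-pi..pi} (\<lambda>x. cis x powi k)"
    unfolding cis_power_int by (auto intro!: continuous_intros)
  have eq: "(\<integral>x. cis x powi k \<partial>angle) = integral {-pi..pi} (\<lambda>x. cis x powi k)"
    by (rule lebesgue_integral_eq_integral[OF continuous_imp_integrable_real[OF cont]]) auto
  show ?thesis
  proof (cases "k = 0")
    case True
    then show ?thesis by (simp add: measure_restrict_space scaleR_conv_of_real)
  next
    case False
    have "((\<lambda>x. cis x powi k) has_integral
            (cis (of_int k * pi) / (\<i> * of_int k) - cis (of_int k * (- pi)) / (\<i> * of_int k))) {-pi..pi}"
      unfolding cis_power_int
    proof (rule fundamental_theorem_of_calculus)
      fix x :: real
      show "((\<lambda>x. cis (of_int k * x) / (\<i> * of_int k)) has_vector_derivative cis (of_int k * x))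
             (at x within {-pi..pi})"
        using False unfolding cis_conv_exp
        by (auto intro!: derivative_eq_intros has_vector_derivative_real_field simp: field_simps)
    qed auto
    moreover have "cis (of_int k * pi) = cis (of_int k * (- pi))"
      by (simp add: complex_eq_iff sin_integer_2pi mult.commute)
    ultimately show ?thesis using False by (simp add: eq integral_unique)
  qed
qed

lemma fourier_eq: "fourier u k = (\<integral>x. u (cis x) * cis x powi (- k) \<partial>angle) / complex_of_real (2 * pi)"
  by (simp add: fourier_def inner_circ_def cnj_circle_char flip: cnj_circle_char complex_cnj_power_int)

text \<open>
  On a set of finite measure, \<open>\<bar>u\<bar> \<le> 1 + \<bar>u\<bar>\<^sup>2\<close> makes square integrable functions integrable.
\<close>

lemma L2_mult_bounded_integrable:
  assumes u: "u \<in> L2" and F: "F \<in> borel_measurable angle" "\<And>x. norm (F x) \<le> B"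
  shows "integrable angle (\<lambda>x. u (cis x) * F x)"
proof (rule Bochner_Integration.integrable_bound)
  have B: "0 \<le> B" using order_trans[OF norm_ge_zero F(2)] .
  show "integrable angle (\<lambda>x. (1 + (cmod (u (cis x)))\<^sup>2) * B)"
    using u by (auto simp: L2_def)
  show "(\<lambda>x. u (cis x) * F x) \<in> borel_measurable angle"
    using u F(1) by (auto simp: L2_def)
  have "cmod (u (cis x)) \<le> 1 + (cmod (u (cis x)))\<^sup>2" for x
    using zero_le_power2[of "cmod (u (cis x)) - 1"] norm_ge_zero[of "u (cis x)"]
    unfolding power2_diff mult_1_right one_power2 by linarith
  then show "AE x in angle. norm (u (cis x) * F x) \<le> norm ((1 + (cmod (u (cis x)))\<^sup>2) * B)"
    using F(2) B by (auto simp: norm_mult intro!: AE_I2 mult_mono)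
qed

lemma L2_fourier_integrable: "u \<in> L2 \<Longrightarrow> integrable angle (\<lambda>x. u (cis x) * cis x powi k)"
  by (rule L2_mult_bounded_integrable[where B = 1]) (use circle_char_measurable in \<open>auto simp: cis_power_int\<close>)

lemma fourier_cong:
  assumes "eq_circ u v"
    and "(\<lambda>x. u (cis x)) \<in> borel_measurable angle" "(\<lambda>x. v (cis x)) \<in> borel_measurable angle"
  shows "fourier u k = fourier v k"
proof -
  have "(\<integral>x. u (cis x) * cis x powi (- k) \<partial>angle) = (\<integral>x. v (cis x) * cis x powi (- k) \<partial>angle)"
    using assms by (intro integral_cong_AE) (auto simp: eq_circ_def elim!: eventually_mono)
  then show ?thesis by (simp add: fourier_eq)
qed

lemma fourier_diff:
  "u \<in> L2 \<Longrightarrow> v \<in> L2 \<Longrightarrow> fourier (\<lambda>z. u z - v z) k = fourier u k - fourier v k"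
  by (simp add: fourier_eq L2_fourier_integrable left_diff_distrib diff_divide_distrib
      Bochner_Integration.integral_diff)

lemma fourier_add:
  "u \<in> L2 \<Longrightarrow> v \<in> L2 \<Longrightarrow> fourier (\<lambda>z. u z + v z) k = fourier u k + fourier v k"
  by (simp add: fourier_eq L2_fourier_integrable distrib_right add_divide_distrib
      Bochner_Integration.integral_add)

lemma fourier_cmult: "fourier (\<lambda>z. c * u z) k = c * fourier u k"
  by (simp add: fourier_eq mult.assoc)

lemma fourier_const: "fourier (\<lambda>_. c) k = (if k = 0 then c else 0)"
  by (simp add: fourier_eq integral_circle_char)

lemma L2_bounded:
  assumes "(\<lambda>x. u (cis x)) \<in> borel_measurable angle" "\<And>x. cmod (u (cis x)) \<le> B"
  shows "u \<in> L2"
  unfolding L2_def using assms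
  by (auto intro!: integrable_angle_bounded[where B = "B\<^sup>2"] power_mono)

lemma L2_cmult: "u \<in> L2 \<Longrightarrow> (\<lambda>z. c * u z) \<in> L2"
  by (auto simp: L2_def norm_mult power_mult_distrib)

lemma L2_add:
  assumes "u \<in> L2" "v \<in> L2"
  shows "(\<lambda>z. u z + v z) \<in> L2"
proof -
  have "integrable angle (\<lambda>x. (cmod (u (cis x) + v (cis x)))\<^sup>2)"
  proof (rule Bochner_Integration.integrable_bound)
    show "integrable angle (\<lambda>x. 2 * (cmod (u (cis x)))\<^sup>2 + 2 * (cmod (v (cis x)))\<^sup>2)"
      using assms by (auto simp: L2_def)
    have "(cmod (a + b))\<^sup>2 \<le> 2 * (cmod a)\<^sup>2 + 2 * (cmod b)\<^sup>2" for a b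
    proof -
      have "(cmod (a + b))\<^sup>2 \<le> (cmod a + cmod b)\<^sup>2"
        by (intro power_mono norm_triangle_ineq) auto
      also have "\<dots> \<le> 2 * (cmod a)\<^sup>2 + 2 * (cmod b)\<^sup>2"
        using zero_le_power2[of "cmod a - cmod b"] by (simp add: power2_eq_square algebra_simps)
      finally show ?thesis .
    qed
    then show "AE x in angle. norm ((cmod (u (cis x) + v (cis x)))\<^sup>2)
        \<le> norm (2 * (cmod (u (cis x)))\<^sup>2 + 2 * (cmod (v (cis x)))\<^sup>2)"
      by (intro AE_I2) (auto intro: order_trans)
  qed (use assms in \<open>auto simp: L2_def\<close>)
  then show ?thesis using assms by (auto simp: L2_def)
qed

lemma L2_diff: "u \<in> L2 \<Longrightarrow> v \<in> L2 \<Longrightarrow> (\<lambda>z. u z - v z) \<in> L2"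
  using L2_add[OF _ L2_cmult[of v "-1"], of u] by simp

text \<open>
  This is the continuity in \<open>L\<^sup>2\<close> through which the time derivative passes to a single coefficient.
  The first absolute moment \<open>m\<close> of \<open>u\<close> bounds the coefficient, and the variance of \<open>\<bar>u\<bar>\<close> about \<open>m\<close> is
  nonnegative.
\<close>

lemma norm_fourier_le_L2_norm:
  assumes u: "u \<in> L2"
  shows "cmod (fourier u k) \<le> L2_norm u"
proof -
  define h where "h x = cmod (u (cis x))" for x
  define m where "m = (\<integral>x. h x \<partial>angle) / (2 * pi)"
  have int2: "integrable angle (\<lambda>x. (h x)\<^sup>2)" using u by (simp add: L2_def h_def)
  have int: "integrable angle h"
    using L2_mult_bounded_integrable[OF u, of "\<lambda>_. 1" 1] integrable_norm
    unfolding h_def by fastforce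
  have "0 \<le> (\<integral>x. (h x - m)\<^sup>2 \<partial>angle)" by (intro integral_nonneg_AE) auto
  also have "(\<integral>x. (h x - m)\<^sup>2 \<partial>angle) = (\<integral>x. (h x)\<^sup>2 - 2 * m * h x + m\<^sup>2 \<partial>angle)"
    by (simp add: power2_eq_square algebra_simps)
  also have "\<dots> = (\<integral>x. (h x)\<^sup>2 \<partial>angle) - 2 * m * (\<integral>x. h x \<partial>angle) + m\<^sup>2 * (2 * pi)"
    using int int2 by (simp add: measure_restrict_space)
  also have "\<dots> = (2 * pi) * ((\<integral>x. (h x)\<^sup>2 \<partial>angle) / (2 * pi) - m\<^sup>2)"
    by (simp add: m_def power2_eq_square field_simps)
  finally have "m\<^sup>2 \<le> (\<integral>x. (h x)\<^sup>2 \<partial>angle) / (2 * pi)"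
    using pi_gt_zero by (auto simp: zero_le_mult_iff dest: leD)
  then have "m \<le> L2_norm u" unfolding L2_norm_def h_def by (rule real_le_rsqrt)
  moreover have "cmod (\<integral>x. u (cis x) * cis x powi (- k) \<partial>angle) \<le> (\<integral>x. h x \<partial>angle)"
    by (rule integral_norm_bound[THEN order_trans]) (simp add: h_def norm_mult cis_power_int)
  then have "cmod (fourier u k) \<le> m"
    by (simp add: fourier_eq m_def norm_divide divide_right_mono)
  ultimately show ?thesis by simp
qed

section \<open>Absolutely convergent Fourier series\<close>

definition circ_series :: "(nat \<Rightarrow> complex) \<Rightarrow> complex \<Rightarrow> complex" where
  "circ_series d z = (\<Sum>n. d n * z ^ n)"

lemma circ_series_measurable [measurable]:
  "(\<lambda>x. circ_series d (cis x)) \<in> borel_measurable angle"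
  unfolding circ_series_def by measurable

lemma norm_circ_series_le:
  assumes "summable (\<lambda>n. cmod (d n))"
  shows "cmod (circ_series d (cis x)) \<le> (\<Sum>n. cmod (d n))"
  unfolding circ_series_def
  using summable_norm[of "\<lambda>n. d n * cis x ^ n"] assms by (simp add: norm_mult norm_power)

lemma circ_series_L2: "summable (\<lambda>n. cmod (d n)) \<Longrightarrow> circ_series d \<in> L2"
  by (rule L2_bounded[OF circ_series_measurable norm_circ_series_le])

lemma sums_integral_circ_series:
  assumes F [measurable]: "F \<in> borel_measurable angle" and F_le: "\<And>x. cmod (F x) \<le> B"
    and d: "summable (\<lambda>n. cmod (d n))"
  shows "(\<lambda>n. d n * (\<integral>x. F x * cis x ^ n \<partial>angle)) sums (\<integral>x. F x * circ_series d (cis x) \<partial>angle)"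
proof -
  have int: "integrable angle (\<lambda>x. F x * cis x ^ n)" for n
    using F_le by (intro integrable_angle_bounded[where B = B]) (auto simp: norm_mult norm_power)
  have d_pt: "summable (\<lambda>n. d n * cis x ^ n)" for x
    by (rule summable_norm_cancel) (use d in \<open>simp add: norm_mult norm_power\<close>)
  have "(\<lambda>n. \<integral>x. d n * (F x * cis x ^ n) \<partial>angle) sums (\<integral>x. (\<Sum>n. d n * (F x * cis x ^ n)) \<partial>angle)"
  proof (rule sums_integral)
    show "AE x in angle. summable (\<lambda>n. norm (d n * (F x * cis x ^ n)))"
      using summable_mult2[OF d] by (simp add: norm_mult norm_power)
    have "(\<lambda>n. \<integral>x. norm (d n * (F x * cis x ^ n)) \<partial>angle)
          = (\<lambda>n. cmod (d n) * (\<integral>x. cmod (F x) \<partial>angle))"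
      by (simp add: norm_mult norm_power)
    then show "summable (\<lambda>n. \<integral>x. norm (d n * (F x * cis x ^ n)) \<partial>angle)"
      using summable_mult2[OF d] by simp
  qed (use int in auto)
  moreover have "(\<Sum>n. d n * (F x * cis x ^ n)) = F x * circ_series d (cis x)" for x
    unfolding circ_series_def by (subst suminf_mult[OF d_pt, symmetric]) (simp add: mult_ac)
  ultimately show ?thesis by simp
qed

lemma fourier_circ_series:
  assumes d: "summable (\<lambda>n. cmod (d n))"
  shows "fourier (circ_series d) k = (if 0 \<le> k then d (nat k) else 0)"
proof -
  let ?I = "\<lambda>n::nat. \<integral>x. cis x powi (- k) * cis x ^ n \<partial>angle"
  have "cis x powi (- k) * cis x ^ n = cis x powi (int n - k)" for x n
    by (simp add: cis_power_int cis_mult Complex.DeMoivre algebra_simps)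
  then have I: "?I n = (if int n = k then complex_of_real (2 * pi) else 0)" for n
    by (simp only: integral_circle_char) simp
  have "(\<lambda>n. d n * ?I n) sums (\<integral>x. cis x powi (- k) * circ_series d (cis x) \<partial>angle)"
    by (rule sums_integral_circ_series[where B = 1])
       (use d circle_char_measurable[of "- k"] in \<open>simp_all add: norm_power_int\<close>)
  moreover have "(\<lambda>n. d n * ?I n) sums (if 0 \<le> k then d (nat k) * complex_of_real (2 * pi) else 0)"
  proof (cases "0 \<le> k")
    case True
    then have "(\<lambda>n. d n * ?I n) = (\<lambda>n. if n = nat k then d n * complex_of_real (2 * pi) else 0)"
      by (auto simp: I fun_eq_iff)
    then show ?thesis using sums_single[of "nat k" "\<lambda>n. d n * complex_of_real (2 * pi)"] True by simp
  next
    case False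
    then have "(\<lambda>n. d n * ?I n) = (\<lambda>n. 0)" by (auto simp: I fun_eq_iff)
    then show ?thesis using False by simp
  qed
  ultimately have "(\<integral>x. cis x powi (- k) * circ_series d (cis x) \<partial>angle)
      = (if 0 \<le> k then d (nat k) * complex_of_real (2 * pi) else 0)"
    by (rule sums_unique2)
  then show ?thesis by (simp add: fourier_eq mult.commute)
qed

text \<open>
  On the circle \<open>cnj z = 1 / z\<close>, so multiplication by the \<open>j\<close>-th term of the conjugate series shifts
  the coefficients of the first factor down by \<open>j\<close>.
\<close>

lemma sums_fourier_mult_cnj:
  assumes d: "summable (\<lambda>n. cmod (d n))" and e: "summable (\<lambda>n. cmod (e n))"
  shows "(\<lambda>j. cnj (e j) * d (k + j)) sums
           fourier (\<lambda>z. circ_series d z * cnj (circ_series e z)) (int k)"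
proof -
  let ?F = "\<lambda>x. cnj (circ_series d (cis x)) * cis x powi (int k)"
  have "(\<lambda>j. e j * (\<integral>x. ?F x * cis x ^ j \<partial>angle)) sums (\<integral>x. ?F x * circ_series e (cis x) \<partial>angle)"
  proof (rule sums_integral_circ_series[where B = "\<Sum>n. cmod (d n)"])
    show "?F \<in> borel_measurable angle"
      using circle_char_measurable by measurable
  qed (use norm_circ_series_le[OF d] e in \<open>auto simp: norm_mult norm_power\<close>)
  then have *: "(\<lambda>j. cnj (e j) * (cnj (\<integral>x. ?F x * cis x ^ j \<partial>angle) / complex_of_real (2 * pi)))
      sums (cnj (\<integral>x. ?F x * circ_series e (cis x) \<partial>angle) / complex_of_real (2 * pi))"
    by (drule_tac sums_cnj[THEN iffD2], drule_tac c = "complex_of_real (2 * pi)" in sums_divide)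
       (simp only: complex_cnj_mult times_divide_eq_right)
  have "cnj (\<integral>x. ?F x * cis x ^ j \<partial>angle) / complex_of_real (2 * pi) = d (k + j)" for j
  proof -
    have "cnj (\<integral>x. ?F x * cis x ^ j \<partial>angle) = (\<integral>x. circ_series d (cis x) * cis x powi (- int (k + j)) \<partial>angle)"
      unfolding Bochner_Integration.integral_cnj[symmetric]
      by (rule Bochner_Integration.integral_cong)
         (auto simp: cis_power_int cis_mult Complex.DeMoivre cis_cnj algebra_simps)
    then show ?thesis using fourier_circ_series[OF d, of "int (k + j)"] by (simp add: fourier_eq nat_add_distrib)
  qed
  moreover have "cnj (\<integral>x. ?F x * circ_series e (cis x) \<partial>angle) / complex_of_real (2 * pi)
       = fourier (\<lambda>z. circ_series d z * cnj (circ_series e z)) (int k)"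
    unfolding fourier_eq Bochner_Integration.integral_cnj[symmetric]
    by (simp add: mult_ac power_int_minus cis_cnj flip: cnj_circle_char power_inverse)
  ultimately show ?thesis using * by simp
qed

text \<open>
  Summing the previous formula over \<open>k\<close> first, every \<open>j\<close> contributes at most \<open>\<bar>e j\<bar>\<close> times the full
  sum of \<open>\<bar>d\<bar>\<close>. This is what places the nonlinearity in the scope of \<open>szego_spec\<close> below.
\<close>

lemma summable_fourier_mult_cnj:
  assumes d: "summable (\<lambda>n. cmod (d n))" and e: "summable (\<lambda>n. cmod (e n))"
  shows "summable (\<lambda>k. cmod (fourier (\<lambda>z. circ_series d z * cnj (circ_series e z)) (int k)))"
proof (rule summableI_nonneg_bounded)
  fix n
  let ?D = "\<Sum>n. cmod (d n)"
  have tail: "cmod (d (k + j)) \<le> ?D" for k j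
    using sum_le_suminf[OF d, of "{k + j}"] by simp
  have sm: "summable (\<lambda>j. cmod (e j) * cmod (d (k + j)))" for k
    by (rule summable_comparison_test'[OF summable_mult2[OF e, of ?D], of 0])
       (auto intro!: mult_left_mono tail)
  have le: "cmod (fourier (\<lambda>z. circ_series d z * cnj (circ_series e z)) (int k))
      \<le> (\<Sum>j. cmod (e j) * cmod (d (k + j)))" for k
    using summable_norm[of "\<lambda>j. cnj (e j) * d (k + j)"] sm[of k]
      sums_unique[OF sums_fourier_mult_cnj[OF d e, of k]] by (simp add: norm_mult)
  have "(\<Sum>k<n. cmod (fourier (\<lambda>z. circ_series d z * cnj (circ_series e z)) (int k)))
      \<le> (\<Sum>k<n. \<Sum>j. cmod (e j) * cmod (d (k + j)))"
    by (intro sum_mono le)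
  also have "\<dots> = (\<Sum>j. \<Sum>k<n. cmod (e j) * cmod (d (k + j)))"
    by (rule suminf_sum[symmetric]) (rule sm)
  also have "\<dots> \<le> (\<Sum>j. cmod (e j) * ?D)"
  proof (rule suminf_le)
    fix j
    have "(\<Sum>k<n. cmod (d (k + j))) = (\<Sum>k\<in>(\<lambda>k. k + j) ` {..<n}. cmod (d k))"
      by (subst sum.reindex) auto
    also have "\<dots> \<le> ?D" by (rule sum_le_suminf[OF d]) auto
    finally show "(\<Sum>k<n. cmod (e j) * cmod (d (k + j))) \<le> cmod (e j) * ?D"
      by (simp add: mult_left_mono flip: sum_distrib_left)
  qed (use sm e in \<open>auto intro: summable_sum summable_mult2\<close>)
  finally show "(\<Sum>k<n. cmod (fourier (\<lambda>z. circ_series d z * cnj (circ_series e z)) (int k)))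
      \<le> (\<Sum>j. cmod (e j) * ?D)" .
qed auto

text \<open>
  The choice in the definition of \<open>szego\<close> is meaningful once a square integrable function with the
  prescribed coefficients exists; when these are absolutely summable their power series is one.
\<close>

lemma szego_spec:
  assumes "summable (\<lambda>k. cmod (fourier f (int k)))"
  shows "szego f \<in> L2 \<and> (\<forall>k. fourier (szego f) k = (if 0 \<le> k then fourier f k else 0))"
proof -
  have "circ_series (\<lambda>n. fourier f (int n)) \<in> L2 \<and>
     (\<forall>k. fourier (circ_series (\<lambda>n. fourier f (int n))) k = (if 0 \<le> k then fourier f k else 0))"
    using circ_series_L2[OF assms] fourier_circ_series[OF assms] by simp
  then show ?thesis
    unfolding szego_def
    by (rule someI[where P = "\<lambda>g. g \<in> L2 \<and> (\<forall>k. fourier g k = (if 0 \<le> k then fourier f k else 0))"])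
qed

section \<open>The cubic nonlinearity on rational functions with one pole\<close>

text \<open>
  Taylor coefficients at 0 of \<open>b + c z / (1 - p z)\<close> and, in the next definition, of its square.
\<close>

definition pole_coeff :: "complex \<Rightarrow> complex \<Rightarrow> complex \<Rightarrow> nat \<Rightarrow> complex" where
  "pole_coeff b c p n = (case n of 0 \<Rightarrow> b | Suc m \<Rightarrow> c * p ^ m)"

definition pole_sq_coeff :: "complex \<Rightarrow> complex \<Rightarrow> complex \<Rightarrow> nat \<Rightarrow> complex" where
  "pole_sq_coeff b c p n =
     (case n of 0 \<Rightarrow> b\<^sup>2 | Suc m \<Rightarrow> 2 * b * c * p ^ m + c\<^sup>2 * (of_nat m * p ^ (m - 1)))"

lemma pole_coeff_simps [simp]:
  "pole_coeff b c p 0 = b" "pole_coeff b c p (Suc m) = c * p ^ m"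
  by (simp_all add: pole_coeff_def)

lemma pole_sq_coeff_simps [simp]:
  "pole_sq_coeff b c p 0 = b\<^sup>2"
  "pole_sq_coeff b c p (Suc m) = 2 * b * c * p ^ m + c\<^sup>2 * (of_nat m * p ^ (m - 1))"
  by (simp_all add: pole_sq_coeff_def)

lemma arith_geometric_sums:
  fixes q :: "'a :: {real_normed_field,banach}"
  assumes "norm q < 1"
  shows "(\<lambda>m. of_nat m * q ^ (m - 1)) sums (1 / (1 - q)\<^sup>2)"
  using geometric_deriv_sums[OF assms] sums_Suc_iff[of "\<lambda>m. of_nat m * q ^ (m - 1)"] by simp

lemma arith_geometric_sums':
  fixes q :: "'a :: {real_normed_field,banach}"
  assumes "norm q < 1"
  shows "(\<lambda>m. of_nat m * q ^ m) sums (q / (1 - q)\<^sup>2)"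
proof -
  have "q * (of_nat m * q ^ (m - 1)) = of_nat m * q ^ m" for m by (cases m) auto
  with sums_mult[OF arith_geometric_sums[OF assms], of q] show ?thesis
    by (simp only:) simp
qed

lemma summable_pole_coeff:
  assumes "cmod p < 1"
  shows "summable (\<lambda>n. cmod (pole_coeff b c p n))"
proof -
  have "summable (\<lambda>m. cmod c * cmod p ^ m)"
    using assms by (intro summable_mult summable_geometric) auto
  then show ?thesis
    by (subst summable_Suc_iff[symmetric]) (simp add: norm_mult norm_power)
qed

lemma summable_pole_sq_coeff:
  assumes "cmod p < 1"
  shows "summable (\<lambda>n. cmod (pole_sq_coeff b c p n))"
proof -
  have "summable (\<lambda>m. cmod (2 * b * c) * cmod p ^ m + cmod (c\<^sup>2) * (of_nat m * cmod p ^ (m - 1)))"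
    using assms arith_geometric_sums[of "cmod p"]
    by (intro summable_add summable_mult summable_geometric) (auto simp: sums_iff)
  then have "summable (\<lambda>m. cmod (pole_sq_coeff b c p (Suc m)))"
    by (rule summable_comparison_test[rotated])
       (auto intro!: exI[of _ 0] order_trans[OF norm_triangle_ineq] simp: norm_mult norm_power)
  then show ?thesis by (subst summable_Suc_iff[symmetric])
qed

lemma circ_series_pole:
  assumes p: "cmod p < 1" and z: "cmod z = 1"
  shows "circ_series (pole_coeff b c p) z = b + c * z / (1 - p * z)"
proof -
  have "(\<lambda>m. c * z * (p * z) ^ m) sums (c * z * (1 / (1 - p * z)))"
    using p z by (intro sums_mult geometric_sums) (simp add: norm_mult)
  then have "(\<lambda>m. pole_coeff b c p (Suc m) * z ^ Suc m) sums (c * z / (1 - p * z))"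
    by (simp add: power_mult_distrib mult_ac)
  then have "(\<lambda>n. pole_coeff b c p n * z ^ n) sums (c * z / (1 - p * z) + b)"
    by (subst (asm) sums_Suc_iff) simp
  then show ?thesis unfolding circ_series_def by (simp add: sums_iff add.commute)
qed

lemma circ_series_pole_sq:
  assumes p: "cmod p < 1" and z: "cmod z = 1"
  shows "circ_series (pole_sq_coeff b c p) z = (b + c * z / (1 - p * z))\<^sup>2"
proof -
  have pz: "norm (p * z) < 1" using p z by (simp add: norm_mult)
  have "(\<lambda>m. 2 * b * c * z * (p * z) ^ m + (c * z)\<^sup>2 * (of_nat m * (p * z) ^ (m - 1)))
      sums (2 * b * c * z * (1 / (1 - p * z)) + (c * z)\<^sup>2 * (1 / (1 - p * z)\<^sup>2))"
    by (intro sums_add sums_mult geometric_sums arith_geometric_sums pz)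
  moreover have "2 * b * c * z * (p * z) ^ m + (c * z)\<^sup>2 * (of_nat m * (p * z) ^ (m - 1))
      = pole_sq_coeff b c p (Suc m) * z ^ Suc m" for m
    by (cases m) (simp_all add: power_mult_distrib power2_eq_square algebra_simps)
  moreover have "2 * b * c * z * (1 / (1 - p * z)) + (c * z)\<^sup>2 * (1 / (1 - p * z)\<^sup>2)
      = (b + c * z / (1 - p * z))\<^sup>2 - b\<^sup>2"
    by (simp add: power2_sum power_divide)
  ultimately have "(\<lambda>m. pole_sq_coeff b c p (Suc m) * z ^ Suc m) sums ((b + c * z / (1 - p * z))\<^sup>2 - b\<^sup>2)"
    by simp
  then have "(\<lambda>n. pole_sq_coeff b c p n * z ^ n) sums ((b + c * z / (1 - p * z))\<^sup>2)"
    by (subst (asm) sums_Suc_iff) simp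
  then show ?thesis unfolding circ_series_def by (simp add: sums_iff)
qed

text \<open>
  The coefficients of \<open>\<bar>u\<bar>\<^sup>2 u = u\<^sup>2 (cnj u)\<close> for \<open>u = b + c z / (1 - p z)\<close>.
\<close>

definition pole_cubic :: "complex \<Rightarrow> complex \<Rightarrow> complex \<Rightarrow> nat \<Rightarrow> complex" where
  "pole_cubic b c p k =
     fourier (\<lambda>z. circ_series (pole_sq_coeff b c p) z * cnj (circ_series (pole_coeff b c p) z)) (int k)"

lemma summable_pole_cubic: "cmod p < 1 \<Longrightarrow> summable (\<lambda>k. cmod (pole_cubic b c p k))"
  unfolding pole_cubic_def
  by (rule summable_fourier_mult_cnj[OF summable_pole_sq_coeff summable_pole_coeff])

text \<open>
  With \<open>q = \<bar>p\<bar>\<^sup>2\<close> the convolution of \<open>sums_fourier_mult_cnj\<close> reduces to the geometric series and its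
  derivative. The third value is written relative to the second because only the difference
  enters the equation of \<open>p\<close>.
\<close>

lemma pole_cubic_values:
  assumes p: "cmod p < 1"
  defines "r \<equiv> 1 - p * cnj p"
  shows pole_cubic_0: "pole_cubic b c p 0
          = b * (b * cnj b) + 2 * b * (c * cnj c) / r + c * (c * cnj c) * cnj p / r\<^sup>2" (is ?th0)
    and pole_cubic_1: "pole_cubic b c p 1
          = 2 * (b * cnj b) * c + 2 * b * p * (c * cnj c) / r + c * (c * cnj c) / r\<^sup>2" (is ?th1)
    and pole_cubic_2: "pole_cubic b c p 2
          = p * pole_cubic b c p 1 + c\<^sup>2 * cnj b + c * (c * cnj c) * p / r" (is ?th2)
proof -
  define q where "q = p * cnj p"
  have q: "norm q < 1"
    using p mult_strict_mono[of "cmod p" 1 "cmod p" 1] by (simp add: q_def norm_mult)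
  have r: "r \<noteq> 0" using q by (auto simp: r_def q_def)
  have g: "(\<lambda>m. q ^ m) sums (1 / r)" and g1: "(\<lambda>m. of_nat m * q ^ (m - 1)) sums (1 / r\<^sup>2)"
    and g2: "(\<lambda>m. of_nat m * q ^ m) sums (q / r\<^sup>2)"
    using geometric_sums[OF q] arith_geometric_sums[OF q] arith_geometric_sums'[OF q]
    by (simp_all add: r_def q_def)
  have conv: "(\<lambda>m. cnj (c * p ^ m) * pole_sq_coeff b c p (k + Suc m)) sums
      (pole_cubic b c p k - cnj b * pole_sq_coeff b c p k)" for k
    using sums_fourier_mult_cnj[OF summable_pole_sq_coeff[OF p] summable_pole_coeff[OF p], of b c b c k]
      sums_Suc_iff[of "\<lambda>j. cnj (pole_coeff b c p j) * pole_sq_coeff b c p (k + j)"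
        "pole_cubic b c p k - cnj b * pole_sq_coeff b c p k"]
    by (simp add: pole_cubic_def)
  have "(\<lambda>m. 2 * b * (c * cnj c) * q ^ m + c * (c * cnj c) * cnj p * (of_nat m * q ^ (m - 1))) sums
     (2 * b * (c * cnj c) * (1 / r) + c * (c * cnj c) * cnj p * (1 / r\<^sup>2))"
    by (intro sums_add sums_mult g g1)
  moreover have "cnj (c * p ^ m) * pole_sq_coeff b c p (0 + Suc m)
     = 2 * b * (c * cnj c) * q ^ m + c * (c * cnj c) * cnj p * (of_nat m * q ^ (m - 1))" for m
    by (cases m) (simp_all add: q_def power_mult_distrib power2_eq_square algebra_simps)
  ultimately show ?th0
    using sums_unique2[OF conv[of 0]] by (simp add: algebra_simps power2_eq_square)
  have "(\<lambda>m. 2 * b * (c * cnj c) * p * q ^ m + c * (c * cnj c) * (of_nat m * q ^ m + q ^ m)) sums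
     (2 * b * (c * cnj c) * p * (1 / r) + c * (c * cnj c) * (q / r\<^sup>2 + 1 / r))"
    by (intro sums_add sums_mult g g2)
  moreover have "cnj (c * p ^ m) * pole_sq_coeff b c p (1 + Suc m)
     = 2 * b * (c * cnj c) * p * q ^ m + c * (c * cnj c) * (of_nat m * q ^ m + q ^ m)" for m
    by (simp add: q_def power_mult_distrib power2_eq_square algebra_simps)
  ultimately have "pole_cubic b c p 1 - cnj b * pole_sq_coeff b c p 1 =
     2 * b * (c * cnj c) * p * (1 / r) + c * (c * cnj c) * (q / r\<^sup>2 + 1 / r)"
    using sums_unique2[OF conv[of 1]] by simp
  moreover have "q / r\<^sup>2 + 1 / r = 1 / r\<^sup>2"
    using r by (simp add: field_simps power2_eq_square) (simp add: r_def q_def algebra_simps)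
  ultimately have "pole_cubic b c p 1 - cnj b * pole_sq_coeff b c p 1 =
     2 * b * (c * cnj c) * p * (1 / r) + c * (c * cnj c) * (1 / r\<^sup>2)"
    by (simp only:)
  then show th1: ?th1
    by (simp add: algebra_simps)
  have "(\<lambda>m. 2 * b * (c * cnj c) * p\<^sup>2 * q ^ m
      + c * (c * cnj c) * p * (of_nat m * q ^ m + 2 * q ^ m)) sums
     (2 * b * (c * cnj c) * p\<^sup>2 * (1 / r) + c * (c * cnj c) * p * (q / r\<^sup>2 + 2 * (1 / r)))"
    by (intro sums_add sums_mult g g2)
  moreover have "cnj (c * p ^ m) * pole_sq_coeff b c p (2 + Suc m)
     = 2 * b * (c * cnj c) * p\<^sup>2 * q ^ m + c * (c * cnj c) * p * (of_nat m * q ^ m + 2 * q ^ m)" for m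
    by (simp add: q_def power_mult_distrib power2_eq_square algebra_simps)
  ultimately have "pole_cubic b c p 2 - cnj b * pole_sq_coeff b c p 2 =
     2 * b * (c * cnj c) * p\<^sup>2 * (1 / r) + c * (c * cnj c) * p * (q / r\<^sup>2 + 2 * (1 / r))"
    using sums_unique2[OF conv[of 2]] by simp
  moreover have "q / r\<^sup>2 + 2 * (1 / r) = 1 / r\<^sup>2 + 1 / r"
    using r by (simp add: field_simps power2_eq_square) (simp add: r_def q_def algebra_simps)
  moreover have "pole_sq_coeff b c p 2 = 2 * b * c * p + c\<^sup>2"
    by (simp add: numeral_2_eq_2)
  ultimately have "pole_cubic b c p 2 - cnj b * (2 * b * c * p + c\<^sup>2) =
     2 * b * (c * cnj c) * p\<^sup>2 * (1 / r) + c * (c * cnj c) * p * (1 / r\<^sup>2 + 1 / r)"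
    by (simp only:)
  then show ?th2
    unfolding th1 by (simp add: algebra_simps power2_eq_square)
qed

section \<open>The equation in the coordinates\<close>

lemma of_real_cmod_square: "(complex_of_real (cmod w))\<^sup>2 = w * cnj w"
  using complex_norm_square[of w] by simp

lemma fourier_pole:
  assumes meas: "(\<lambda>x. u (cis x)) \<in> borel_measurable angle"
    and p: "cmod p < 1" and u: "eq_circ u (\<lambda>z. b + c * z / (1 - p * z))"
  shows "fourier u k = (if 0 \<le> k then pole_coeff b c p (nat k) else 0)"
proof -
  have "eq_circ u (circ_series (pole_coeff b c p))"
    using u circ_series_pole[OF p] by (simp add: eq_circ_def)
  then show ?thesis
    using fourier_cong[OF _ meas circ_series_measurable] fourier_circ_series[OF summable_pole_coeff[OF p]]
    by simp
qed

lemma fourier_cubic_pole: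
  assumes meas [measurable]: "(\<lambda>x. u (cis x)) \<in> borel_measurable angle"
    and p: "cmod p < 1" and u: "eq_circ u (\<lambda>z. b + c * z / (1 - p * z))"
  shows "fourier (\<lambda>z. (complex_of_real (cmod (u z)))\<^sup>2 * u z) (int k) = pole_cubic b c p k"
  unfolding pole_cubic_def
proof (rule fourier_cong)
  have "(complex_of_real (cmod w))\<^sup>2 * w = w\<^sup>2 * cnj w" for w
    by (simp add: of_real_cmod_square power2_eq_square[of w] mult_ac)
  then show "eq_circ (\<lambda>z. (complex_of_real (cmod (u z)))\<^sup>2 * u z)
     (\<lambda>z. circ_series (pole_sq_coeff b c p) z * cnj (circ_series (pole_coeff b c p) z))"
    using u circ_series_pole[OF p] circ_series_pole_sq[OF p]
    by (auto simp: eq_circ_def simp del: complex_cnj_add elim!: eventually_mono)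
qed measurable

text \<open>
  The coefficient of the \<open>L\<^sup>2\<close> remainder of the difference quotient is, up to the factor \<open>\<i>\<close>, the
  remainder of the difference quotient of the coefficient.
\<close>

lemma solution_fourier_derivative:
  assumes sol: "szego_solution \<alpha> u"
    and p: "cmod p < 1" and u: "eq_circ (u t) (\<lambda>z. b + c * z / (1 - p * z))"
  shows "((\<lambda>t. fourier (u t) (int k)) has_vector_derivative
           - \<i> * (pole_cubic b c p k + (if k = 0 then complex_of_real \<alpha> * b else 0))) (at t)"
proof -
  let ?f = "\<lambda>t. fourier (u t) (int k)"
  let ?N = "\<lambda>w. (complex_of_real (cmod (u t w)))\<^sup>2 * u t w"
  let ?W = "pole_cubic b c p k + (if k = 0 then complex_of_real \<alpha> * b else 0)"
  define R where "R h = (\<lambda>z. \<i> * ((u (t + h) z - u t z) / complex_of_real h)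
      - (szego ?N z + complex_of_real \<alpha> * inner_circ (u t) (\<lambda>_. 1)))" for h
  have uL2: "u s \<in> L2" for s using sol by (auto simp: szego_solution_def H_plus_def L2_plus_def)
  then have meas: "(\<lambda>x. u t (cis x)) \<in> borel_measurable angle" by (simp add: L2_def)
  have sz: "szego ?N \<in> L2" "fourier (szego ?N) (int k) = pole_cubic b c p k"
    using szego_spec[of ?N] fourier_cubic_pole[OF meas p u] summable_pole_cubic[OF p] by simp_all
  have in0: "inner_circ (u t) (\<lambda>_. 1) = b"
    using fourier_pole[OF meas p u, of 0] by (simp add: fourier_def)
  have const: "(\<lambda>_. x) \<in> L2" for x by (rule L2_bounded[of _ "cmod x"]) auto
  have R_eq: "R h = (\<lambda>z. \<i> / complex_of_real h * (u (t + h) z - u t z)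
      - (szego ?N z + complex_of_real \<alpha> * inner_circ (u t) (\<lambda>_. 1)))" for h
    by (simp add: R_def)
  have R_L2: "R h \<in> L2" for h
    unfolding R_eq by (intro L2_diff L2_add L2_cmult uL2 sz const)
  have R_fourier: "fourier (R h) (int k) = \<i> / complex_of_real h * (?f (t + h) - ?f t) - ?W" for h
    unfolding R_eq
    by (subst fourier_diff; (intro L2_diff L2_add L2_cmult uL2 sz const)?)
       (simp only: fourier_cmult fourier_diff[OF uL2 uL2] fourier_add[OF sz(1) const] sz(2) fourier_const in0, simp)
  have "((\<lambda>h. L2_norm (R h)) \<longlongrightarrow> 0) (at 0)"
    using sol unfolding szego_solution_def R_def by blast
  then have "((\<lambda>h. fourier (R h) (int k)) \<longlongrightarrow> 0) (at 0)"
    by (rule Lim_null_comparison[rotated]) (simp add: norm_fourier_le_L2_norm R_L2)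
  then have "((\<lambda>h. cmod (- \<i> * fourier (R h) (int k))) \<longlongrightarrow> 0) (at 0)"
    by (intro tendsto_norm_zero tendsto_mult_right_zero)
  then have "((\<lambda>h. cmod (?f (t + h) - ?f t - h *\<^sub>R (- \<i> * ?W)) / cmod (complex_of_real h)) \<longlongrightarrow> 0) (at 0)"
  proof (rule Lim_transform_eventually)
    have "cmod (- \<i> * fourier (R h) (int k))
        = cmod (?f (t + h) - ?f t - h *\<^sub>R (- \<i> * ?W)) / cmod (complex_of_real h)" if "h \<noteq> 0" for h
      unfolding norm_divide[symmetric] R_fourier using that
      by (intro arg_cong[where f = cmod]) (simp add: field_simps scaleR_conv_of_real)
    then show "\<forall>\<^sub>F h in at 0. cmod (- \<i> * fourier (R h) (int k))
        = cmod (?f (t + h) - ?f t - h *\<^sub>R (- \<i> * ?W)) / cmod (complex_of_real h)"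
      by (auto simp: eventually_at_filter)
  qed
  then show ?thesis
    unfolding has_vector_derivative_def has_derivative_at
    by (intro conjI bounded_linear_scaleR_left) simp
qed

section \<open>Conserved quantities and non-collapse of the pole\<close>

lemma has_derivative_norm_square:
  fixes f :: "real \<Rightarrow> complex"
  assumes "(f has_vector_derivative f') (at t)"
  shows "((\<lambda>t. (cmod (f t))\<^sup>2) has_real_derivative 2 * Re (cnj (f t) * f')) (at t)"
proof -
  have "((\<lambda>t. Re (f t * cnj (f t))) has_vector_derivative Re (f t * cnj f' + f' * cnj (f t))) (at t)"
    by (intro bounded_linear.has_vector_derivative[OF bounded_linear_Re]
        has_vector_derivative_mult has_vector_derivative_cnj assms)
  moreover have "Re (f t * cnj f' + f' * cnj (f t)) = 2 * Re (cnj (f t) * f')"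
    by (simp add: algebra_simps)
  ultimately show ?thesis
    by (simp add: has_real_derivative_iff_has_vector_derivative complex_mult_cnj cmod_power2 mult_ac)
qed

text \<open>
  The motion of the coefficients of index 0, 1 and 2. The third equation is for \<open>c p\<close> and not for \<open>p\<close>
  because \<open>p\<close> need not even be continuous where \<open>c\<close> vanishes.
\<close>

locale pole_flow =
  fixes \<alpha> :: real and b c p :: "real \<Rightarrow> complex"
  assumes p_less_1: "cmod (p t) < 1"
    and b_deriv: "(b has_vector_derivative
          - \<i> * (pole_cubic (b t) (c t) (p t) 0 + complex_of_real \<alpha> * b t)) (at t)"
    and c_deriv: "(c has_vector_derivative - \<i> * pole_cubic (b t) (c t) (p t) 1) (at t)"
    and cp_deriv: "((\<lambda>t. c t * p t) has_vector_derivative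
          - \<i> * pole_cubic (b t) (c t) (p t) 2) (at t)"
begin

definition r :: "real \<Rightarrow> real" where "r t = 1 - (cmod (p t))\<^sup>2"

definition mass :: "real \<Rightarrow> real" where "mass t = (cmod (b t))\<^sup>2 + (cmod (c t))\<^sup>2 / r t"

definition momentum :: "real \<Rightarrow> real" where "momentum t = (cmod (c t))\<^sup>2 / (r t)\<^sup>2"

text \<open>
  All the conserved quantities are functions of \<open>\<bar>b\<bar>\<^sup>2\<close>, \<open>\<bar>c\<bar>\<^sup>2\<close>, \<open>\<bar>p\<bar>\<^sup>2\<close> and the real part
  of this product; its imaginary part drives the motion of each of them.
\<close>

definition Z :: "real \<Rightarrow> complex" where "Z t = cnj (b t) * c t * cnj (p t)"

text \<open>
  This is \<open>r (\<bar>b + c (cnj p) / r\<bar>\<^sup>2 - \<alpha>)\<close>, that is \<open>r (\<bar>u(cnj p)\<bar>\<^sup>2 - \<alpha>)\<close>, multiplied out.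
\<close>

definition pole_energy :: "real \<Rightarrow> real" where
  "pole_energy t = r t * (cmod (b t))\<^sup>2 + (cmod (c t))\<^sup>2 / r t - (cmod (c t))\<^sup>2
     + 2 * Re (Z t) - \<alpha> * r t"

lemma r_pos: "0 < r t" and r_le_1: "r t \<le> 1"
  using p_less_1[of t] by (auto simp: r_def power_less_one_iff abs_square_less_1)

lemma of_real_r: "complex_of_real (r t) = 1 - p t * cnj (p t)"
  by (simp add: r_def of_real_cmod_square)

lemma continuous_c: "continuous_on UNIV c"
  using c_deriv by (meson continuous_at_imp_continuous_on has_vector_derivative_continuous)

lemma cubic:
  "pole_cubic (b t) (c t) (p t) 0 = (cmod (b t))\<^sup>2 * b t + (2 * (cmod (c t))\<^sup>2 / r t) * b t
      + ((cmod (c t))\<^sup>2 / (r t)\<^sup>2) * (c t * cnj (p t))"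
  "pole_cubic (b t) (c t) (p t) 1 = (2 * (cmod (b t))\<^sup>2) * c t + (2 * (cmod (c t))\<^sup>2 / r t) * (b t * p t)
      + ((cmod (c t))\<^sup>2 / (r t)\<^sup>2) * c t"
  "pole_cubic (b t) (c t) (p t) 2 = p t * pole_cubic (b t) (c t) (p t) 1 + c t * (c t * cnj (b t)
      + ((cmod (c t))\<^sup>2 / r t) * p t)"
  using pole_cubic_0[OF p_less_1[of t], of "b t" "c t"] pole_cubic_1[OF p_less_1[of t], of "b t" "c t"]
    pole_cubic_2[OF p_less_1[of t], of "b t" "c t"]
  by (simp_all add: of_real_cmod_square of_real_r power2_eq_square[of "c t"] algebra_simps)

text \<open>
  Near a time at which \<open>c\<close> does not vanish, \<open>p\<close> is the quotient of the differentiable functions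
  \<open>c p\<close> and \<open>c\<close>. In its derivative the terms with the coefficient of index 1 cancel.
\<close>

lemma p_deriv:
  assumes "c t \<noteq> 0"
  shows "(p has_vector_derivative - \<i> * (c t * cnj (b t) + ((cmod (c t))\<^sup>2 / r t) * p t)) (at t)"
proof (rule has_vector_derivative_transform_within_open)
  let ?N = "pole_cubic (b t) (c t) (p t)"
  have inv_deriv: "((\<lambda>t. inverse (c t)) has_vector_derivative
      (- \<i> * ?N 1) * (- (inverse (c t) * inverse (c t)))) (at t)"
    using field_vector_diff_chain_at[OF c_deriv, of inverse "- (inverse (c t) * inverse (c t))" t]
      DERIV_inverse'[OF DERIV_ident, of "c t"] assms by (simp add: o_def mult_ac)
  have "(x * q) * ((- \<i> * n) * (- (inverse x * inverse x))) + (- \<i> * (q * n + x * y)) * inverse x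
      = - \<i> * y" if "x \<noteq> 0" for x q n y :: complex
    using that by (simp add: field_simps)
  from this[OF assms, of "p t" "?N 1" "c t * cnj (b t) + ((cmod (c t))\<^sup>2 / r t) * p t", folded cubic(3)]
  show "((\<lambda>t. (c t * p t) * inverse (c t)) has_vector_derivative
      - \<i> * (c t * cnj (b t) + ((cmod (c t))\<^sup>2 / r t) * p t)) (at t)"
    using has_vector_derivative_mult[OF cp_deriv inv_deriv] by (simp only:)
  show "open {t. c t \<noteq> 0}"
    using continuous_c by (intro open_Collect_neq) auto
qed (use assms in auto)

lemma norm_squares:
  "b t * cnj (b t) = complex_of_real ((cmod (b t))\<^sup>2)"
  "c t * cnj (c t) = complex_of_real ((cmod (c t))\<^sup>2)"
  "p t * cnj (p t) = complex_of_real ((cmod (p t))\<^sup>2)"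
  by (simp_all add: of_real_cmod_square)

lemma r_deriv:
  assumes "c t \<noteq> 0"
  shows "(r has_real_derivative - 2 * Im (Z t)) (at t)"
proof -
  define k where "k = (cmod (c t))\<^sup>2 / r t"
  have "cnj (p t) * (- \<i> * (c t * cnj (b t) + k * p t))
      = - \<i> * (Z t + of_real (k * (cmod (p t))\<^sup>2))"
    unfolding of_real_mult norm_squares[symmetric] by (simp add: Z_def algebra_simps)
  then have "2 * Re (cnj (p t) * (- \<i> * (c t * cnj (b t) + k * p t))) = 2 * Im (Z t)"
    by (simp only:) simp
  with has_derivative_norm_square[OF p_deriv[OF assms, folded k_def]]
  have "((\<lambda>t. (cmod (p t))\<^sup>2) has_real_derivative 2 * Im (Z t)) (at t)"
    by (simp only:)
  from DERIV_diff[OF DERIV_const this, of 1] show ?thesis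
    by (simp add: r_def[abs_def])
qed

lemma b_square_deriv:
  "((\<lambda>t. (cmod (b t))\<^sup>2) has_real_derivative 2 * Im (Z t) * ((cmod (c t))\<^sup>2 / (r t)\<^sup>2)) (at t)"
proof -
  define B k m where "B = (cmod (b t))\<^sup>2" and "k = (cmod (c t))\<^sup>2 / r t" and "m = (cmod (c t))\<^sup>2 / (r t)\<^sup>2"
  have N: "pole_cubic (b t) (c t) (p t) 0 = B * b t + (2 * k) * b t + m * (c t * cnj (p t))"
    by (simp add: cubic B_def k_def m_def)
  have "cnj (b t) * (- \<i> * (pole_cubic (b t) (c t) (p t) 0 + complex_of_real \<alpha> * b t))
      = - \<i> * (of_real (B + 2 * k + \<alpha>) * (b t * cnj (b t)) + m * Z t)"
    unfolding N by (simp add: Z_def algebra_simps)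
  also have "\<dots> = - \<i> * (of_real ((B + 2 * k + \<alpha>) * B) + m * Z t)"
    by (simp add: norm_squares B_def)
  finally have "2 * Re (cnj (b t) * (- \<i> * (pole_cubic (b t) (c t) (p t) 0 + complex_of_real \<alpha> * b t)))
      = 2 * Im (Z t) * m"
    by (simp only:) simp
  with has_derivative_norm_square[OF b_deriv[of t]] show ?thesis
    unfolding m_def by (simp only:)
qed

lemma c_square_deriv:
  "((\<lambda>t. (cmod (c t))\<^sup>2) has_real_derivative - 4 * Im (Z t) * ((cmod (c t))\<^sup>2 / r t)) (at t)"
proof -
  define B k m where "B = (cmod (b t))\<^sup>2" and "k = (cmod (c t))\<^sup>2 / r t" and "m = (cmod (c t))\<^sup>2 / (r t)\<^sup>2"
  have N: "pole_cubic (b t) (c t) (p t) 1 = (2 * B) * c t + (2 * k) * (b t * p t) + m * c t"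
    using cubic(2)[of t] by (simp add: B_def k_def m_def)
  have "cnj (c t) * (- \<i> * pole_cubic (b t) (c t) (p t) 1)
      = - \<i> * (of_real (2 * B + m) * (c t * cnj (c t)) + of_real (2 * k) * cnj (Z t))"
    unfolding N by (simp add: Z_def algebra_simps)
  also have "\<dots> = - \<i> * (of_real ((2 * B + m) * (cmod (c t))\<^sup>2) + of_real (2 * k) * cnj (Z t))"
    by (simp add: norm_squares)
  finally have "2 * Re (cnj (c t) * (- \<i> * pole_cubic (b t) (c t) (p t) 1)) = - 4 * Im (Z t) * k"
    by (simp only:) simp
  with has_derivative_norm_square[OF c_deriv[of t]] show ?thesis
    unfolding k_def by (simp only:)
qed

lemma Re_Z_deriv:
  assumes "c t \<noteq> 0"
  shows "((\<lambda>t. Re (Z t)) has_real_derivative Im (Z t) *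
           ((cmod (b t))\<^sup>2 - 3 * ((cmod (c t))\<^sup>2 / r t) - \<alpha> + (cmod (c t))\<^sup>2 / (r t)\<^sup>2)) (at t)"
proof -
  define B X k m where "B = (cmod (b t))\<^sup>2" and "X = (cmod (c t))\<^sup>2"
    and "k = (cmod (c t))\<^sup>2 / r t" and "m = (cmod (c t))\<^sup>2 / (r t)\<^sup>2"
  define b' c' p' where "b' = - \<i> * (pole_cubic (b t) (c t) (p t) 0 + complex_of_real \<alpha> * b t)"
    and "c' = - \<i> * pole_cubic (b t) (c t) (p t) 1"
    and "p' = - \<i> * (c t * cnj (b t) + ((cmod (c t))\<^sup>2 / r t) * p t)"
  have N: "b' = - \<i> * (B * b t + (2 * k) * b t + m * (c t * cnj (p t)) + complex_of_real \<alpha> * b t)"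
    "c' = - \<i> * ((2 * B) * c t + (2 * k) * (b t * p t) + m * c t)"
    "p' = - \<i> * (c t * cnj (b t) + k * p t)"
    using cubic(1,2)[of t] by (simp_all add: b'_def c'_def p'_def B_def k_def m_def)
  let ?D = "cnj (b t) * c t * cnj p' + (cnj (b t) * c' + cnj b' * c t) * cnj (p t)"
  have "((\<lambda>t. Re (Z t)) has_vector_derivative Re ?D) (at t)"
    unfolding Z_def
    by (intro bounded_linear.has_vector_derivative[OF bounded_linear_Re]
        has_vector_derivative_mult has_vector_derivative_cnj
        b_deriv[of t, folded b'_def] c_deriv[of t, folded c'_def] p_deriv[OF assms, folded p'_def])
  moreover have "?D = \<i> * ((b t * cnj (b t)) * (c t * cnj (c t)) + of_real m * ((c t * cnj (c t)) * (p t * cnj (p t)))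
      - of_real (2 * k) * ((b t * cnj (b t)) * (p t * cnj (p t)))
      + of_real (3 * k + \<alpha> - B - m) * Z t)"
    unfolding N by (simp add: Z_def algebra_simps)
  then have "?D = \<i> * (of_real (B * X + m * (X * (cmod (p t))\<^sup>2) - 2 * k * (B * (cmod (p t))\<^sup>2))
      + of_real (3 * k + \<alpha> - B - m) * Z t)"
    by (simp only: norm_squares of_real_mult of_real_add of_real_diff B_def X_def)
  then have "Re ?D = Im (Z t) * (B - 3 * k - \<alpha> + m)"
    by (simp only:) (simp add: algebra_simps)
  ultimately show ?thesis
    by (simp only: has_real_derivative_iff_has_vector_derivative B_def k_def m_def)
qed

text \<open>
  By the four derivatives above, \<open>Im (Z t)\<close> factors out of each derivative, and its cofactor, a rational
  function of \<open>\<bar>b\<bar>\<^sup>2\<close>, \<open>\<bar>c\<bar>\<^sup>2\<close>, \<open>r\<close> and \<open>\<alpha>\<close>, vanishes identically.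
\<close>

lemma conservation_laws:
  assumes "c t \<noteq> 0"
  shows "(mass has_real_derivative 0) (at t)"
    and "(momentum has_real_derivative 0) (at t)"
    and "(pole_energy has_real_derivative 0) (at t)"
proof -
  note D = r_deriv[OF assms] b_square_deriv[of t] c_square_deriv[of t] Re_Z_deriv[OF assms]
  have r: "r t \<noteq> 0" using r_pos[of t] by simp
  note c2_r = DERIV_divide[OF D(3,1) r]
  show "(mass has_real_derivative 0) (at t)"
    unfolding mass_def[abs_def]
    by (rule DERIV_cong[OF DERIV_add[OF D(2) c2_r]]) (use r in \<open>simp add: field_simps power2_eq_square\<close>)
  have "(\<lambda>t. (cmod (c t))\<^sup>2 / r t / r t) = momentum"
    by (simp add: momentum_def fun_eq_iff power2_eq_square)
  then show "(momentum has_real_derivative 0) (at t)"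
    using DERIV_cong[OF DERIV_divide[OF c2_r D(1) r], of 0] r by (simp add: field_simps)
  show "(pole_energy has_real_derivative 0) (at t)"
    unfolding pole_energy_def[abs_def]
    by (rule DERIV_cong[OF DERIV_diff[OF DERIV_add[OF DERIV_diff[OF DERIV_add[OF
            DERIV_mult[OF D(1,2)] c2_r] D(3)] DERIV_cmult[OF D(4)]] DERIV_cmult[OF D(1)]]])
       (use r in \<open>simp add: field_simps power2_eq_square\<close>)
qed

text \<open>
  Expand \<open>(r \<bar>b\<bar> - \<bar>c\<bar> \<bar>p\<bar>)\<^sup>2 \<ge> 0\<close> and divide by \<open>r\<close>; the right-hand side is
  \<open>r \<bar>b\<bar>\<^sup>2 + \<bar>c\<bar>\<^sup>2 \<bar>p\<bar>\<^sup>2 / r\<close>.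
\<close>

lemma Z_bound: "2 * \<bar>Re (Z t)\<bar> \<le> r t * (cmod (b t))\<^sup>2 + (cmod (c t))\<^sup>2 / r t - (cmod (c t))\<^sup>2"
proof -
  have r: "0 < r t" by (rule r_pos)
  have "0 \<le> (r t * cmod (b t) - cmod (c t) * cmod (p t))\<^sup>2 / r t"
    using r by simp
  also have "\<dots> = r t * (cmod (b t))\<^sup>2 + (cmod (c t))\<^sup>2 * (cmod (p t))\<^sup>2 / r t
       - 2 * (cmod (b t) * cmod (c t) * cmod (p t))"
    using r by (simp add: power2_eq_square field_simps)
  also have "(cmod (c t))\<^sup>2 * (cmod (p t))\<^sup>2 / r t = (cmod (c t))\<^sup>2 / r t - (cmod (c t))\<^sup>2"
  proof -
    have "(cmod (p t))\<^sup>2 = 1 - r t" by (simp add: r_def)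
    then show ?thesis using r by (simp only:) (simp add: field_simps)
  qed
  finally show ?thesis
    using abs_Re_le_cmod[of "Z t"] by (simp add: Z_def norm_mult)
qed

lemma pole_energy_ge: "- \<alpha> * r t \<le> pole_energy t"
  using Z_bound[of t] by (simp add: pole_energy_def)

lemma momentum_nonneg: "0 \<le> momentum t" and b_le_mass: "(cmod (b t))\<^sup>2 \<le> mass t"
  and mass_nonneg: "0 \<le> mass t"
  using r_pos[of t] by (simp_all add: momentum_def mass_def)

text \<open>
  \<open>Z_bound\<close> again, now as an upper bound, together with \<open>\<bar>c\<bar>\<^sup>2 / r = M r\<close>: the factor \<open>r\<close> on the
  right-hand side is what makes the comparison with \<open>pole_energy_ge\<close> useful.
\<close>

lemma pole_energy_le: "pole_energy t \<le> (2 * mass t + 2 * momentum t - \<alpha>) * r t"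
proof -
  have r: "0 < r t" by (rule r_pos)
  have "(cmod (c t))\<^sup>2 / r t = momentum t * r t"
    using r by (simp add: momentum_def power2_eq_square)
  moreover have "r t * (cmod (b t))\<^sup>2 \<le> mass t * r t"
    using r b_le_mass[of t] by (simp add: mult.commute)
  moreover have "0 \<le> (cmod (c t))\<^sup>2" by simp
  ultimately show ?thesis
    using Z_bound[of t] abs_ge_self[of "Re (Z t)"]
    unfolding pole_energy_def ring_distribs by linarith
qed

lemma c_square_eq: "(cmod (c t))\<^sup>2 = momentum t * (r t)\<^sup>2"
  using r_pos[of t] by (simp add: momentum_def)

lemma conserved_while_nonconstant:
  assumes "connected S" "open S" "s \<in> S" "t \<in> S" and nz: "\<And>x. x \<in> S \<Longrightarrow> c x \<noteq> 0"
  shows "mass t = mass s" "momentum t = momentum s" "pole_energy t = pole_energy s"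
proof -
  have "f t = f s" if "\<And>x. x \<in> S \<Longrightarrow> (f has_real_derivative 0) (at x)" for f :: "real \<Rightarrow> real"
    using has_field_derivative_0_imp_constant_on[OF that assms(1,2)] assms(3,4)
    by (auto simp: constant_on_def)
  then show "mass t = mass s" "momentum t = momentum s" "pole_energy t = pole_energy s"
    using conservation_laws nz by blast+
qed

text \<open>
  The bound that keeps the pole away from the circle when \<open>\<alpha> < 0\<close>: \<open>pole_energy_ge\<close> at time \<open>s\<close>
  meets \<open>pole_energy_le\<close> at time \<open>t\<close>.
\<close>

lemma r_lower_bound:
  assumes "mass t = mass s" "momentum t = momentum s" "pole_energy t = pole_energy s"
  shows "- \<alpha> * r s \<le> (2 * mass s + 2 * momentum s - \<alpha>) * r t"
  using pole_energy_ge[of s] pole_energy_le[of t] assms by simp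

text \<open>
  On the component \<open>S\<close> of \<open>s\<close> in \<open>{c \<noteq> 0}\<close> the conservation laws and \<open>r_lower_bound\<close> give
  \<open>\<bar>c\<bar>\<^sup>2 \<ge> M \<delta>\<^sup>2 > 0\<close>. By continuity this persists on the closure of \<open>S\<close>, which is connected and
  therefore contained in \<open>S\<close>.
\<close>

lemma never_constant:
  assumes \<alpha>: "\<alpha> < 0" and s: "c s \<noteq> 0"
  shows "c t \<noteq> 0" "mass t = mass s" "momentum t = momentum s"
    "- \<alpha> * r s \<le> (2 * mass s + 2 * momentum s - \<alpha>) * r t"
proof -
  define A where "A = {t. c t \<noteq> 0}"
  define S where "S = connected_component_set A s"
  have "open A" unfolding A_def using continuous_c by (intro open_Collect_neq) auto
  then have S: "open S" "connected S" "S \<subseteq> A" "s \<in> S"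
    using s by (auto simp: S_def A_def open_connected_component connected_component_subset
        connected_component_refl)
  have nz: "c x \<noteq> 0" if "x \<in> S" for x using S that by (auto simp: A_def)
  have conserved: "mass x = mass s" "momentum x = momentum s" "pole_energy x = pole_energy s"
    if "x \<in> S" for x
    using conserved_while_nonconstant[OF S(2,1,4) that] nz by auto
  define K where "K = 2 * mass s + 2 * momentum s - \<alpha>"
  have K: "0 < K" using \<alpha> mass_nonneg[of s] momentum_nonneg[of s] by (simp add: K_def)
  define \<delta> where "\<delta> = - \<alpha> * r s / K"
  have \<delta>: "0 < \<delta>" using \<alpha> r_pos[of s] K by (simp add: \<delta>_def mult_neg_pos divide_neg_pos)
  have M: "0 < momentum s" using s r_pos[of s] by (simp add: momentum_def)
  have bound: "momentum s * \<delta>\<^sup>2 \<le> (cmod (c x))\<^sup>2" if "x \<in> S" for x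
  proof -
    have "\<delta> \<le> r x"
      using r_lower_bound[OF conserved[OF that]] K by (simp add: \<delta>_def field_simps K_def)
    then have "momentum s * \<delta>\<^sup>2 \<le> momentum s * (r x)\<^sup>2"
      using M \<delta> by (intro mult_left_mono power_mono) auto
    then show ?thesis using c_square_eq[of x] conserved(2)[OF that] by simp
  qed
  have "closed {x. momentum s * \<delta>\<^sup>2 \<le> (cmod (c x))\<^sup>2}"
    using continuous_c by (intro closed_Collect_le continuous_intros)
  then have "closure S \<subseteq> {x. momentum s * \<delta>\<^sup>2 \<le> (cmod (c x))\<^sup>2}"
    using bound by (intro closure_minimal) auto
  also have "\<dots> \<subseteq> A"
  proof -
    have "0 < momentum s * \<delta>\<^sup>2" using M \<delta> by simp
    then show ?thesis by (auto simp: A_def)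
  qed
  \<comment> \<open>A connected set containing \<open>s\<close> and contained in \<open>A\<close> lies in the component of \<open>s\<close>.\<close>
  finally have "closure S \<subseteq> A" .
  moreover have "s \<in> closure S" "connected (closure S)"
    using S closure_subset[of S] by (auto intro: connected_imp_connected_closure)
  ultimately have "closure S \<subseteq> S"
    by (metis S_def connected_component_maximal)
  then have "closed S" using closure_subset_eq by blast
  then have "S = UNIV"
    using S connected_clopen[of "UNIV :: real set"] connected_UNIV by auto
  then have t: "t \<in> S" by simp
  show "c t \<noteq> 0" by (rule nz[OF t])
  show "mass t = mass s" "momentum t = momentum s" by (rule conserved[OF t])+
  show "- \<alpha> * r s \<le> (2 * mass s + 2 * momentum s - \<alpha>) * r t"
    by (rule r_lower_bound[OF conserved[OF t]])
qed

text \<open>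
  If \<open>c\<close> vanishes identically, the mass is \<open>\<bar>b\<bar>\<^sup>2\<close>, whose derivative has \<open>\<bar>c\<bar>\<^sup>2\<close> as a factor.
\<close>

lemma mass_momentum_const:
  assumes \<alpha>: "\<alpha> < 0"
  shows "mass t = mass s" "momentum t = momentum s"
proof -
  have "mass t = mass s \<and> momentum t = momentum s"
  proof (cases "\<exists>x. c x \<noteq> 0")
    case True
    then obtain x where "c x \<noteq> 0" by blast
    then show ?thesis
      using never_constant(2,3)[OF \<alpha>, of x t] never_constant(2,3)[OF \<alpha>, of x s] by simp
  next
    case False
    then have c0: "c x = 0" for x by simp
    have "((\<lambda>t. (cmod (b t))\<^sup>2) has_real_derivative 0) (at x)" for x
      using b_square_deriv[of x] c0[of x] by simp
    then have "(cmod (b t))\<^sup>2 = (cmod (b s))\<^sup>2"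
      by (rule DERIV_isconst_all[rule_format, of _ t s])
    then show ?thesis using c0 by (simp add: mass_def momentum_def)
  qed
  then show "mass t = mass s" "momentum t = momentum s" by auto
qed

lemma c_square_le_momentum: "(cmod (c t))\<^sup>2 \<le> momentum t"
proof -
  have "(r t)\<^sup>2 \<le> 1" using r_pos[of t] r_le_1[of t] by (simp add: power_le_one)
  then show ?thesis
    using mult_left_mono[of "(r t)\<^sup>2" 1 "momentum t"] momentum_nonneg[of t] by (simp add: c_square_eq)
qed

text \<open>
  \<open>Q\<close> and \<open>M\<close> bound mass and momentum at time 0, and \<open>\<sigma>\<close> bounds \<open>\<bar>p\<bar>\<^sup>2 = 1 - r\<close> where
  \<open>c \<noteq> 0\<close>. The decay is stated for the coefficients \<open>c p\<^sup>m\<close> and not for \<open>p\<close>, so that it holds also where \<open>c\<close> vanishes and \<open>p\<close>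
  is arbitrary.
\<close>

lemma uniform_bounds:
  assumes \<alpha>: "\<alpha> < 0" and \<rho>: "0 < \<rho>" "\<rho> \<le> r 0" and B: "cmod (b 0) \<le> B" "cmod (c 0) \<le> B"
  defines "Q \<equiv> B\<^sup>2 + B\<^sup>2 / \<rho>" and "M \<equiv> B\<^sup>2 / \<rho>\<^sup>2"
  defines "\<sigma> \<equiv> max 0 (1 - - \<alpha> * \<rho> / (2 * Q + 2 * M - \<alpha>))"
  shows "(cmod (b t))\<^sup>2 \<le> Q"
    and "(cmod (c t * p t ^ m))\<^sup>2 \<le> M * \<sigma> ^ m"
proof -
  have b2: "(cmod (b 0))\<^sup>2 \<le> B\<^sup>2" and c2: "(cmod (c 0))\<^sup>2 \<le> B\<^sup>2"
    using B by (simp_all add: power_mono)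
  have Q: "mass 0 \<le> Q"
    unfolding mass_def Q_def using \<rho> r_pos[of 0] b2 c2
    by (intro add_mono frac_le) auto
  have M: "momentum 0 \<le> M"
    unfolding momentum_def M_def using \<rho> r_pos[of 0] c2
    by (intro frac_le c2) (auto intro: power_mono)
  show "(cmod (b t))\<^sup>2 \<le> Q"
    using b_le_mass[of t] mass_momentum_const(1)[OF \<alpha>, of t 0] Q by simp
  define K where "K = 2 * Q + 2 * M - \<alpha>"
  have K: "0 < K" using \<alpha> Q M mass_nonneg[of 0] momentum_nonneg[of 0] by (simp add: K_def)
  have c: "(cmod (c t))\<^sup>2 \<le> M"
    using c_square_le_momentum[of t] mass_momentum_const(2)[OF \<alpha>, of t 0] M by simp
  have M0: "0 \<le> M" by (simp add: M_def)
  have gap: "- \<alpha> * \<rho> / K \<le> r t" if "c t \<noteq> 0"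
  proof -
    have c0: "c 0 \<noteq> 0" using never_constant(1)[OF \<alpha> that] .
    have "- \<alpha> * \<rho> \<le> - \<alpha> * r 0" using \<alpha> \<rho> by (simp add: mult_left_mono_neg)
    also have "\<dots> \<le> (2 * mass 0 + 2 * momentum 0 - \<alpha>) * r t" by (rule never_constant(4)[OF \<alpha> c0])
    also have "\<dots> \<le> K * r t"
      using r_pos[of t] Q M by (intro mult_right_mono) (auto simp: K_def)
    finally show ?thesis using K by (simp add: field_simps)
  qed
  show "(cmod (c t * p t ^ m))\<^sup>2 \<le> M * \<sigma> ^ m"
  proof (cases "c t = 0")
    case True
    then show ?thesis using M0 by (simp add: \<sigma>_def)
  next
    case False
    have "(cmod (c t * p t ^ m))\<^sup>2 = (cmod (c t))\<^sup>2 * (1 - r t) ^ m"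
      by (simp add: norm_mult norm_power power_mult_distrib r_def power_mult[symmetric] mult.commute)
    also have "\<dots> \<le> M * \<sigma> ^ m"
      using c gap[OF False] M0 r_le_1[of t]
      by (intro mult_mono power_mono) (auto simp: \<sigma>_def K_def)
    finally show ?thesis .
  qed
qed

end

section \<open>Sobolev bounds\<close>

text \<open>
  The ratio \<open>\<sigma>\<close> is first raised to at least \<open>1/2\<close>, so that it has the form \<open>exp (- l)\<close>, and the
  exponential decay absorbs the weight.
\<close>

lemma summable_weighted_geometric:
  assumes "0 \<le> \<sigma>" "\<sigma> < 1"
  shows "summable (\<lambda>m. (1 + (real m + 1)\<^sup>2) powr s * \<sigma> ^ m)"
proof -
  define l where "l = - ln (max \<sigma> (1/2))"
  have l: "0 < l" using assms by (auto simp: l_def max_def)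
  have "\<sigma> \<le> exp (- l)" using assms by (simp add: l_def)
  then have le: "\<sigma> ^ m \<le> exp (- l * real m)" for m
    using power_mono[of \<sigma> "exp (- l)" m] assms by (simp add: exp_of_nat_mult[symmetric] mult.commute)
  have "summable (\<lambda>m. (1 + (real m + 1)\<^sup>2) powr s * exp (- l * real m))"
  proof (rule summable_comparison_test_bigo)
    show "summable (\<lambda>m. norm (1 / real m ^ 2))"
      using inverse_power_summable[of 2, where 'a = real] by (simp add: field_simps)
    show "(\<lambda>m. (1 + (real m + 1)\<^sup>2) powr s * exp (- l * real m)) \<in> O(\<lambda>m. 1 / real m ^ 2)"
      using l by real_asymp
  qed
  then show ?thesis
    by (rule summable_comparison_test'[where N = 0])
       (use assms le in \<open>auto intro!: mult_left_mono\<close>)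
qed

lemma H_plus_from_decay:
  assumes u: "u \<in> L2_plus" and \<sigma>: "0 \<le> \<sigma>" "\<sigma> < 1"
    and f0: "(cmod (fourier u 0))\<^sup>2 \<le> Q"
    and f: "\<And>m. (cmod (fourier u (int (Suc m))))\<^sup>2 \<le> M * \<sigma> ^ m"
  shows "u \<in> H_plus s"
    and "H_norm s u \<le> sqrt (Q + M * (\<Sum>m. (1 + (real m + 1)\<^sup>2) powr s * \<sigma> ^ m))"
proof -
  define w where "w k = (1 + (real_of_int k)\<^sup>2) powr s * (cmod (fourier u k))\<^sup>2" for k :: int
  define g where "g n = (case n of 0 \<Rightarrow> Q | Suc m \<Rightarrow> M * ((1 + (real m + 1)\<^sup>2) powr s * \<sigma> ^ m))" for n
  have w_neg: "w k = 0" if "k < 0" for k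
    using u that by (simp add: w_def L2_plus_def)
  have w_g: "w (int n) \<le> g n" for n
  proof (cases n)
    case (Suc m)
    then show ?thesis
      using mult_left_mono[OF f[of m], of "(1 + (real m + 1)\<^sup>2) powr s"]
      by (simp add: w_def g_def mult_ac add.commute)
  qed (use f0 in \<open>simp add: w_def g_def\<close>)
  have w_nonneg: "0 \<le> w k" for k by (simp add: w_def)
  have "(\<lambda>m. g (Suc m)) sums (M * (\<Sum>m. (1 + (real m + 1)\<^sup>2) powr s * \<sigma> ^ m))"
    unfolding g_def nat.case by (intro sums_mult summable_sums summable_weighted_geometric \<sigma>)
  then have g: "g sums (M * (\<Sum>m. (1 + (real m + 1)\<^sup>2) powr s * \<sigma> ^ m) + Q)"
    by (subst (asm) sums_Suc_iff) (simp add: g_def)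
  have w_sum: "summable (\<lambda>n. norm (w (int n)))"
    by (rule summable_comparison_test'[OF sums_summable[OF g], of 0]) (simp add: w_nonneg w_g)
  have hs: "((w \<circ> int) has_sum (\<Sum>n. w (int n))) UNIV"
    using norm_summable_imp_has_sum[OF w_sum] w_sum w_nonneg by (simp add: o_def summable_sums)
  then have "(w has_sum (\<Sum>n. w (int n))) (range int)"
    by (subst has_sum_reindex) auto
  then have *: "(w has_sum (\<Sum>n. w (int n))) UNIV"
  proof (rule has_sum_cong_neutral[THEN iffD1, rotated -1])
    show "w k = 0" if "k \<in> UNIV - range int" for k
      using that w_neg[of k] by (metis DiffD2 nonneg_int_cases not_less rangeI)
  qed auto
  then show "u \<in> H_plus s"
    using u by (auto simp: H_plus_def w_def[abs_def] summable_on_def)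
  have "(\<Sum>n. w (int n)) \<le> Q + M * (\<Sum>m. (1 + (real m + 1)\<^sup>2) powr s * \<sigma> ^ m)"
    using suminf_le[of "\<lambda>n. w (int n)" g] w_g w_sum w_nonneg g by (simp add: sums_iff)
  then show "H_norm s u \<le> sqrt (Q + M * (\<Sum>m. (1 + (real m + 1)\<^sup>2) powr s * \<sigma> ^ m))"
    using infsumI[OF *] by (simp add: H_norm_def w_def[abs_def])
qed

lemma solution_pole_form:
  assumes "solution_from \<alpha> u0 u a b p"
  defines "c \<equiv> \<lambda>t. a t + b t * p t"
  shows "cmod (p t) < 1" "eq_circ (u t) (\<lambda>z. b t + c t * z / (1 - p t * z))"
    and "(\<lambda>x. u t (cis x)) \<in> borel_measurable angle" "u t \<in> L2_plus"
proof -
  show p: "cmod (p t) < 1" using assms(1) by (simp add: solution_from_def)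
  have "(a t * z + b t) / (1 - p t * z) = b t + c t * z / (1 - p t * z)" if "cmod z = 1" for z
  proof -
    have "cmod (p t * z) \<noteq> cmod 1" using p that by (simp add: norm_mult)
    then have "1 - p t * z \<noteq> 0" by auto
    then show ?thesis by (simp add: c_def field_simps)
  qed
  moreover have "eq_circ (u t) (\<lambda>z. (a t * z + b t) / (1 - p t * z))"
    using assms(1) by (simp add: solution_from_def)
  ultimately show "eq_circ (u t) (\<lambda>z. b t + c t * z / (1 - p t * z))"
    by (simp add: eq_circ_def)
  show "u t \<in> L2_plus" using assms(1) by (simp add: solution_from_def szego_solution_def H_plus_def)
  then show "(\<lambda>x. u t (cis x)) \<in> borel_measurable angle" by (simp add: L2_plus_def L2_def)
qed

lemma solution_pole_flow:
  assumes sol: "solution_from \<alpha> u0 u a b p"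
  shows "pole_flow \<alpha> b (\<lambda>t. a t + b t * p t) p"
proof
  fix t
  let ?c = "\<lambda>t. a t + b t * p t"
  note pole = solution_pole_form[OF sol]
  note fourier = fourier_pole[OF pole(3,1,2)]
  have "szego_solution \<alpha> u" using sol by (simp add: solution_from_def)
  note deriv = solution_fourier_derivative[OF this pole(1,2)[of t]]
  show "cmod (p t) < 1" by (rule pole)
  show "(b has_vector_derivative
      - \<i> * (pole_cubic (b t) (?c t) (p t) 0 + complex_of_real \<alpha> * b t)) (at t)"
    using deriv[where k = 0] by (simp add: fourier)
  show "(?c has_vector_derivative - \<i> * pole_cubic (b t) (?c t) (p t) 1) (at t)"
    using deriv[where k = 1] by (simp add: fourier)
  show "((\<lambda>t. ?c t * p t) has_vector_derivative - \<i> * pole_cubic (b t) (?c t) (p t) 2) (at t)"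
    using deriv[where k = 2] by (simp add: fourier numeral_2_eq_2)
qed

lemma uniform_H_bound:
  assumes \<alpha>: "\<alpha> < 0" and \<rho>: "0 < \<rho>"
  obtains C where "C > 0"
    and "\<forall>u0 u a b p t. solution_from \<alpha> u0 u a b p \<and> cmod (b 0) \<le> B \<and>
      cmod (a 0 + b 0 * p 0) \<le> B \<and> \<rho> \<le> 1 - (cmod (p 0))\<^sup>2 \<longrightarrow>
      u t \<in> H_plus s \<and> H_norm s (u t) < C"
proof -
  define Q M where "Q = B\<^sup>2 + B\<^sup>2 / \<rho>" and "M = B\<^sup>2 / \<rho>\<^sup>2"
  \<comment> \<open>The maximum with 0 only serves to make \<open>\<sigma>\<close> a legitimate ratio of a geometric series.\<close>
  define \<sigma> where "\<sigma> = max 0 (1 - - \<alpha> * \<rho> / (2 * Q + 2 * M - \<alpha>))"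
  define C where "C = sqrt (Q + M * (\<Sum>m. (1 + (real m + 1)\<^sup>2) powr s * \<sigma> ^ m))"
  have QM: "0 \<le> Q" "0 \<le> M" using \<rho> by (simp_all add: Q_def M_def)
  have "0 < 2 * Q + 2 * M - \<alpha>" using QM \<alpha> by simp
  then have "0 < - \<alpha> * \<rho> / (2 * Q + 2 * M - \<alpha>)"
    using \<alpha> \<rho> by (intro divide_pos_pos mult_pos_pos) auto
  then have \<sigma>: "0 \<le> \<sigma>" "\<sigma> < 1" by (simp_all add: \<sigma>_def)
  have "0 \<le> (\<Sum>m. (1 + (real m + 1)\<^sup>2) powr s * \<sigma> ^ m)"
    using \<sigma> by (intro suminf_nonneg summable_weighted_geometric) auto
  then have C: "0 \<le> C" using QM by (simp add: C_def)
  have "u t \<in> H_plus s \<and> H_norm s (u t) < C + 1"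
    if sol: "solution_from \<alpha> u0 u a b p" and B: "cmod (b 0) \<le> B" "cmod (a 0 + b 0 * p 0) \<le> B"
      and p0: "\<rho> \<le> 1 - (cmod (p 0))\<^sup>2" for u0 u a b p t
  proof -
    interpret pole_flow \<alpha> b "\<lambda>t. a t + b t * p t" p by (rule solution_pole_flow[OF sol])
    have "\<rho> \<le> r 0" using p0 by (simp add: r_def)
    note bounds = uniform_bounds[OF \<alpha> \<rho> this B, folded Q_def M_def, folded \<sigma>_def, of t]
    note pole = solution_pole_form[OF sol, of t]
    have "u t \<in> H_plus s \<and> H_norm s (u t) \<le> C"
      using H_plus_from_decay[OF pole(4) \<sigma>, of Q M s] bounds fourier_pole[OF pole(3,1,2)]
      by (simp add: C_def nat_add_distrib)
    then show ?thesis by simp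
  qed
  with C show thesis by (intro that[of "C + 1"]) auto
qed

text \<open>
  The coefficients of index 0, 1, 2 determine \<open>b\<close>, \<open>c\<close> and \<open>c p\<close>, and \<open>c'\<close> is not 0. Hence the coordinates
  of a solution at time 0 are those by which compactness is measured.
\<close>

lemma coord_fun_eq_circ_unique:
  assumes q: "(b', c', p') \<in> coord_dom" and p: "cmod p < 1"
    and eq: "eq_circ (coord_fun (b', c', p')) (\<lambda>z. b + c * z / (1 - p * z))"
  shows "b = b'" "c = c'" "p = p'"
proof -
  have p': "cmod p' < 1" and c': "c' \<noteq> 0" using q by (auto simp: coord_dom_def)
  have "eq_circ (circ_series (pole_coeff b' c' p')) (circ_series (pole_coeff b c p))"
    using eq circ_series_pole[OF p] circ_series_pole[OF p'] by (simp add: eq_circ_def coord_fun_def)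
  then have "fourier (circ_series (pole_coeff b' c' p')) (int n) = fourier (circ_series (pole_coeff b c p)) (int n)" for n
    by (rule fourier_cong) (rule circ_series_measurable)+
  then have n: "pole_coeff b' c' p' n = pole_coeff b c p n" for n
    by (simp add: fourier_circ_series summable_pole_coeff p p')
  show "b = b'" using n[of 0] by simp
  show c: "c = c'" using n[of 1] by simp
  show "p = p'" using n[of 2] c c' by (simp add: numeral_2_eq_2)
qed

text \<open>
  On a compact set of coordinates \<open>1 - \<bar>p\<bar>\<^sup>2\<close> attains its minimum, which is positive because the set
  lies inside the coordinate domain.
\<close>

lemma compact_coordinates_bounded:
  assumes "compact Q" "Q \<subseteq> coord_dom"
  obtains B \<rho> where "0 < \<rho>"
    and "\<And>b c p. (b, c, p) \<in> Q \<Longrightarrow> cmod b \<le> B \<and> cmod c \<le> B \<and> \<rho> \<le> 1 - (cmod p)\<^sup>2"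
proof (cases "Q = {}")
  case True
  then show ?thesis using that[of 1 0] by simp
next
  case False
  obtain B where B: "\<And>q. q \<in> Q \<Longrightarrow> norm q \<le> B"
    using compact_imp_bounded[OF assms(1)] by (auto simp: bounded_iff)
  have "continuous_on Q (\<lambda>q. 1 - (cmod (snd (snd q)))\<^sup>2)"
    by (intro continuous_intros)
  then obtain q where q: "q \<in> Q" "\<And>q'. q' \<in> Q \<Longrightarrow> 1 - (cmod (snd (snd q)))\<^sup>2 \<le> 1 - (cmod (snd (snd q')))\<^sup>2"
    using continuous_attains_inf[OF assms(1) False] by blast
  show ?thesis
  proof (rule that)
    show "0 < 1 - (cmod (snd (snd q)))\<^sup>2"
      using q(1) assms(2) by (auto simp: coord_dom_def abs_square_less_1)
    fix b c p assume "(b, c, p) \<in> Q"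
    then show "cmod b \<le> B \<and> cmod c \<le> B \<and> 1 - (cmod (snd (snd q)))\<^sup>2 \<le> 1 - (cmod p)\<^sup>2"
      using B[of "(b, c, p)"] q(2)[of "(b, c, p)"] norm_fst_le[of b "(c, p)"]
        norm_snd_le[of "(c, p)" b] norm_fst_le[of c p] by auto
  qed
qed

theorem theorem3p3:
  fixes \<alpha> :: real
  assumes "\<alpha> < 0"
  shows "(\<forall>u0\<in>L1. \<forall>u a b p. solution_from \<alpha> u0 u a b p \<longrightarrow>
            (\<forall>s\<ge>1/2. \<exists>C>0. \<forall>t. u t \<in> H_plus s \<and> H_norm s (u t) < C))
       \<and> (\<forall>s\<ge>1/2. \<forall>K. compact_in_L1 K \<longrightarrow>
            (\<exists>C>0. \<forall>u0\<in>K. \<forall>u a b p. solution_from \<alpha> u0 u a b p \<longrightarrow>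
               (\<forall>t. u t \<in> H_plus s \<and> H_norm s (u t) < C)))"
proof (intro conjI ballI allI impI)
  fix u0 u a b p and s :: real
  assume sol: "solution_from \<alpha> u0 u a b p"
  define \<rho> where "\<rho> = 1 - (cmod (p 0))\<^sup>2"
  define B where "B = max (cmod (b 0)) (cmod (a 0 + b 0 * p 0))"
  have \<rho>: "0 < \<rho>"
    using solution_pole_form(1)[OF sol, of 0] by (simp add: \<rho>_def abs_square_less_1)
  obtain C where "C > 0" and C: "\<forall>u0 u a b p t. solution_from \<alpha> u0 u a b p \<and> cmod (b 0) \<le> B \<and>
      cmod (a 0 + b 0 * p 0) \<le> B \<and> \<rho> \<le> 1 - (cmod (p 0))\<^sup>2 \<longrightarrow>
      u t \<in> H_plus s \<and> H_norm s (u t) < C"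
    using uniform_H_bound[OF assms \<rho>] by metis
  have "u t \<in> H_plus s \<and> H_norm s (u t) < C" for t
    using sol by (intro C[rule_format, of u0 u a b p t]) (simp add: B_def \<rho>_def)
  with \<open>C > 0\<close> show "\<exists>C>0. \<forall>t. u t \<in> H_plus s \<and> H_norm s (u t) < C"
    by blast
next
  fix s :: real and K
  assume "compact_in_L1 K"
  then obtain Q where Q: "compact Q" "Q \<subseteq> coord_dom"
    and cover: "\<And>u0. u0 \<in> K \<Longrightarrow> \<exists>q\<in>Q. eq_circ u0 (coord_fun q)"
    unfolding compact_in_L1_def by metis
  obtain B \<rho> where \<rho>: "0 < \<rho>"
    and bnd: "\<And>b c p. (b, c, p) \<in> Q \<Longrightarrow> cmod b \<le> B \<and> cmod c \<le> B \<and> \<rho> \<le> 1 - (cmod p)\<^sup>2"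
    using compact_coordinates_bounded[OF Q] by metis
  have init: "cmod (b 0) \<le> B \<and> cmod (a 0 + b 0 * p 0) \<le> B \<and> \<rho> \<le> 1 - (cmod (p 0))\<^sup>2"
    if u0: "u0 \<in> K" and sol: "solution_from \<alpha> u0 u a b p" for u0 u a b p
  proof -
    obtain b' c' p' where q: "(b', c', p') \<in> Q" "eq_circ u0 (coord_fun (b', c', p'))"
      using cover[OF u0] by (metis prod_cases3)
    note pole = solution_pole_form[OF sol, of 0]
    have "eq_circ (u 0) u0" using sol by (simp add: solution_from_def)
    then have "eq_circ (coord_fun (b', c', p')) (\<lambda>z. b 0 + (a 0 + b 0 * p 0) * z / (1 - p 0 * z))"
      using q(2) pole(2) unfolding eq_circ_def by eventually_elim simp
    note coord = coord_fun_eq_circ_unique[OF subsetD[OF Q(2) q(1)] pole(1) this]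
    show ?thesis
      using bnd[OF q(1)] unfolding coord[symmetric] .
  qed
  obtain C where "C > 0" and C: "\<forall>u0 u a b p t. solution_from \<alpha> u0 u a b p \<and> cmod (b 0) \<le> B \<and>
      cmod (a 0 + b 0 * p 0) \<le> B \<and> \<rho> \<le> 1 - (cmod (p 0))\<^sup>2 \<longrightarrow>
      u t \<in> H_plus s \<and> H_norm s (u t) < C"
    using uniform_H_bound[OF assms \<rho>] by metis
  show "\<exists>C>0. \<forall>u0\<in>K. \<forall>u a b p. solution_from \<alpha> u0 u a b p \<longrightarrow>
       (\<forall>t. u t \<in> H_plus s \<and> H_norm s (u t) < C)"
  proof (intro exI[of _ C] conjI[OF \<open>C > 0\<close>] ballI allI impI)
    fix u0 u a b p t
    assume "u0 \<in> K" and sol: "solution_from \<alpha> u0 u a b p"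
    with init[OF this] show "u t \<in> H_plus s \<and> H_norm s (u t) < C"
      by (intro C[rule_format, of u0 u a b p t]) simp
  qed
qed

end
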